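(* Given a set $P$ of $n$ points in $d$-dimensional space $\mathbb{R}^d$, a $1$-ply unit hypercube cover of $P$ whose size is at most $2^{d-1}$ times the size of any minimum-sized $1$-ply unit hypercube cover of $P$ can be generated in $O(d\cdot n\log n)$ time.
   Context: A unit hypercube in $\mathbb{R}^d$ is a closed axis-aligned hypercube $\prod_{i=1}^d[a_i,a_i+1]$ with $a_i\in\mathbb{R}$. For a set $\mathcal{S}$ of geometric objects in $\mathbb{R}^d$, $\mathsf{ply}(\mathcal{S})=\max_{p\in\mathbb{R}^d}|\{s\in\mathcal{S}: p\in s\}|$. A $1$-ply unit hypercube cover of $P$ is a finite set $\mathcal{S}$ of unit hypercubes whose union contains $P$ and with $\mathsf{ply}(\mathcal{S})\le 1$, i.e. the hypercubes are pairwise disjoint (they do not even touch). The size of a cover is its number of hypercubes. The hypercubes may be placed anywhere in space. *)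

theory Defs
  imports Complex_Main "HOL-Library.FuncSet" "HOL-Library.Landau_Symbols"
begin

section \<open>Unit hypercubes, ply and covers\<close>

text \<open>The dimension varies inside the main statement (one algorithm serves all dimensions), so
  d-dimensional space is a carrier set of extensional functions rather than a type.\<close>

definition Rspace :: "nat \<Rightarrow> (nat \<Rightarrow> real) set" where
  "Rspace d = {..<d} \<rightarrow>\<^sub>E UNIV"

definition hypercube :: "nat \<Rightarrow> (nat \<Rightarrow> real) \<Rightarrow> (nat \<Rightarrow> real) set" where
  "hypercube d a = (\<Pi>\<^sub>E i\<in>{..<d}. {a i .. a i + 1})"

definition unit_hypercube :: "nat \<Rightarrow> (nat \<Rightarrow> real) set \<Rightarrow> bool" where
  "unit_hypercube d H \<longleftrightarrow> (\<exists>a. H = hypercube d a)"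

text \<open>Only meaningful for finite families, for which the set of values is finite.\<close>

definition ply :: "nat \<Rightarrow> (nat \<Rightarrow> real) set set \<Rightarrow> nat" where
  "ply d S = Max ((\<lambda>p. card {H \<in> S. p \<in> H}) ` Rspace d)"

definition one_ply_cover :: "nat \<Rightarrow> (nat \<Rightarrow> real) set \<Rightarrow> (nat \<Rightarrow> real) set set \<Rightarrow> bool" where
  "one_ply_cover d P S \<longleftrightarrow>
     finite S \<and> (\<forall>H\<in>S. unit_hypercube d H) \<and> P \<subseteq> \<Union>S \<and> ply d S \<le> 1"

definition min_one_ply_cover :: "nat \<Rightarrow> (nat \<Rightarrow> real) set \<Rightarrow> (nat \<Rightarrow> real) set set \<Rightarrow> bool" where
  "min_one_ply_cover d P S \<longleftrightarrow> is_arg_min card (one_ply_cover d P) S"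


section \<open>A real RAM\<close>

text \<open>Programs are structured commands over finitely many unbounded arrays of natural numbers and
  of reals, with indirect addressing; a scalar variable is entry 0 of an array. Every operation
  has unit cost. As usual for the unit-cost model, integers can only be added and subtracted and
  reals cannot be rounded to integers; real constants are rational, so a program cannot carry
  an arbitrary real as advice. Subtraction of natural numbers is truncated, and division by 0
  yields 0.\<close>

type_synonym vname = string

record ram =
  nmem :: "vname \<Rightarrow> nat \<Rightarrow> nat"
  rmem :: "vname \<Rightarrow> nat \<Rightarrow> real"

datatype nexp =
    NConst nat
  | NGet vname nexp
  | NAdd nexp nexp
  | NSub nexp nexp

datatype rexp =
    RConst rat
  | RGet vname nexp
  | RAdd rexp rexp
  | RSub rexp rexp
  | RMul rexp rexp
  | RDiv rexp rexp

datatype bexp =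
    NLess nexp nexp
  | RLess rexp rexp
  | BNot bexp
  | BAnd bexp bexp

datatype com =
    Skip
  | NSet vname nexp nexp
  | RSet vname nexp rexp
  | Seq com com
  | Cond bexp com com
  | While bexp com

fun nval :: "nexp \<Rightarrow> ram \<Rightarrow> nat" where
  "nval (NConst k) s = k"
| "nval (NGet x e) s = nmem s x (nval e s)"
| "nval (NAdd e f) s = nval e s + nval f s"
| "nval (NSub e f) s = nval e s - nval f s"

fun rval :: "rexp \<Rightarrow> ram \<Rightarrow> real" where
  "rval (RConst q) s = of_rat q"
| "rval (RGet x e) s = rmem s x (nval e s)"
| "rval (RAdd e f) s = rval e s + rval f s"
| "rval (RSub e f) s = rval e s - rval f s"
| "rval (RMul e f) s = rval e s * rval f s"
| "rval (RDiv e f) s = rval e s / rval f s"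

fun bval :: "bexp \<Rightarrow> ram \<Rightarrow> bool" where
  "bval (NLess e f) s \<longleftrightarrow> nval e s < nval f s"
| "bval (RLess e f) s \<longleftrightarrow> rval e s < rval f s"
| "bval (BNot b) s \<longleftrightarrow> \<not> bval b s"
| "bval (BAnd b c) s \<longleftrightarrow> bval b s \<and> bval c s"

fun ncost :: "nexp \<Rightarrow> nat" where
  "ncost (NConst k) = 1"
| "ncost (NGet x e) = 1 + ncost e"
| "ncost (NAdd e f) = 1 + ncost e + ncost f"
| "ncost (NSub e f) = 1 + ncost e + ncost f"

fun rcost :: "rexp \<Rightarrow> nat" where
  "rcost (RConst q) = 1"
| "rcost (RGet x e) = 1 + ncost e"
| "rcost (RAdd e f) = 1 + rcost e + rcost f"
| "rcost (RSub e f) = 1 + rcost e + rcost f"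
| "rcost (RMul e f) = 1 + rcost e + rcost f"
| "rcost (RDiv e f) = 1 + rcost e + rcost f"

fun bcost :: "bexp \<Rightarrow> nat" where
  "bcost (NLess e f) = 1 + ncost e + ncost f"
| "bcost (RLess e f) = 1 + rcost e + rcost f"
| "bcost (BNot b) = 1 + bcost b"
| "bcost (BAnd b c) = 1 + bcost b + bcost c"

definition nupd :: "vname \<Rightarrow> nat \<Rightarrow> nat \<Rightarrow> ram \<Rightarrow> ram" where
  "nupd x i v s = s\<lparr>nmem := (nmem s)(x := (nmem s x)(i := v))\<rparr>"

definition rupd :: "vname \<Rightarrow> nat \<Rightarrow> real \<Rightarrow> ram \<Rightarrow> ram" where
  "rupd x i v s = s\<lparr>rmem := (rmem s)(x := (rmem s x)(i := v))\<rparr>"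

text \<open>\<open>exec c s t s'\<close>: started in s, the command c halts in s' after exactly t steps.\<close>

inductive exec :: "com \<Rightarrow> ram \<Rightarrow> nat \<Rightarrow> ram \<Rightarrow> bool" where
  Skip: "exec Skip s 1 s"
| NSet: "exec (NSet x i e) s (1 + ncost i + ncost e) (nupd x (nval i s) (nval e s) s)"
| RSet: "exec (RSet x i e) s (1 + ncost i + rcost e) (rupd x (nval i s) (rval e s) s)"
| Seq: "exec c1 s t1 s' \<Longrightarrow> exec c2 s' t2 s'' \<Longrightarrow> exec (Seq c1 c2) s (t1 + t2) s''"
| CondTrue: "bval b s \<Longrightarrow> exec c1 s t s' \<Longrightarrow> exec (Cond b c1 c2) s (1 + bcost b + t) s'"
| CondFalse: "\<not> bval b s \<Longrightarrow> exec c2 s t s' \<Longrightarrow> exec (Cond b c1 c2) s (1 + bcost b + t) s'"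
| WhileFalse: "\<not> bval b s \<Longrightarrow> exec (While b c) s (1 + bcost b) s"
| WhileTrue: "bval b s \<Longrightarrow> exec c s t1 s' \<Longrightarrow> exec (While b c) s' t2 s''
    \<Longrightarrow> exec (While b c) s (1 + bcost b + t1 + t2) s''"

inductive_cases SkipE: "exec Skip s t s'"
inductive_cases NSetE: "exec (NSet x i e) s t s'"
inductive_cases RSetE: "exec (RSet x i e) s t s'"
inductive_cases SeqE: "exec (Seq c1 c2) s t s'"
inductive_cases CondE: "exec (Cond b c1 c2) s t s'"
inductive_cases WhileE: "exec (While b c) s t s'"

lemma exec_deterministic:
  "exec c s t s' \<Longrightarrow> exec c s u s'' \<Longrightarrow> u = t \<and> s'' = s'"
proof (induction arbitrary: u s'' rule: exec.induct)
  case (Seq c1 s t1 s1 c2 t2 s2)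
  from Seq.prems show ?case by (rule SeqE) (metis Seq.IH)
next
  case (CondTrue b s c1 t s1 c2)
  from CondTrue.prems show ?case by (rule CondE) (auto dest: CondTrue.IH simp: CondTrue.hyps(1))
next
  case (CondFalse b s c2 t s1 c1)
  from CondFalse.prems show ?case by (rule CondE) (auto dest: CondFalse.IH simp: CondFalse.hyps(1))
next
  case (WhileFalse b s c)
  from WhileFalse.prems show ?case by (rule WhileE) (auto simp: WhileFalse.hyps)
next
  case (WhileTrue b s c t1 s1 t2 s2)
  from WhileTrue.prems show ?case
    by (rule WhileE) (auto simp: WhileTrue.hyps(1) dest!: WhileTrue.IH)
qed (auto elim: SkipE NSetE RSetE)


section \<open>Input and output conventions\<close>

text \<open>Points and hypercubes are stored consecutively, d coordinates each, without repetitions;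
  a hypercube is given by its lowest corner. Memory that does not hold the input is
  arbitrary, and so is the order in which the points are listed.\<close>

definition ram_input :: "nat \<Rightarrow> (nat \<Rightarrow> real) set \<Rightarrow> ram \<Rightarrow> bool" where
  "ram_input d P s \<longleftrightarrow>
     nmem s ''d'' 0 = d \<and> nmem s ''n'' 0 = card P \<and>
     bij_betw (\<lambda>i. \<lambda>j\<in>{..<d}. rmem s ''P'' (i * d + j)) {..<card P} P"

definition ram_output :: "nat \<Rightarrow> (nat \<Rightarrow> real) set set \<Rightarrow> ram \<Rightarrow> bool" where
  "ram_output d S s \<longleftrightarrow>
     bij_betw (\<lambda>i. hypercube d (\<lambda>j. rmem s ''C'' (i * d + j))) {..<nmem s ''m'' 0} S"

end

theory Submission
  imports Defs
begin

text \<open>Sweep along the first coordinate: the leftmost point not yet covered opens a closed slab of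
  width 1 starting there, so that consecutive slabs are disjoint. Subdivide every slab in the same
  way along the second coordinate, and so on; the final cells are disjoint unit hypercubes. On a
  line this greedy choice is optimal, and each further direction costs a factor of at most 2,
  because an interval of length 1 meets at most two disjoint intervals of length 1. Sorting the
  points by (cell, next coordinate) before each of the d sweeps takes \<open>O(d n log n)\<close> steps in total.\<close>

section \<open>Hypercubes\<close>

text \<open>The direction that costs no factor is the last one. On every level i some point lies
  exactly at the start of a given slab, but it agrees with the cell only on the levels up to i and
  may leave it later; only for \<open>i = d - 1\<close> does it belong to the final cell itself. One
  point per cell thus pins down the last start exactly and the other \<open>d - 1\<close> starts
  only up to an error of 1, which is where \<open>2 ^ (d - 1)\<close> comes from. The time bound
  forbids comparing whole corners, since that costs d steps per comparison. Each level renumbers the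
  cells by consecutive natural numbers, so the sort key is a pair of numbers and is compared in
  constant time. Reals cannot be rounded on this machine, so slabs start at input coordinates and
  not on a grid. Closed cubes must not even touch, hence all separations are strictly greater than
  1.\<close>

lemma hypercube_cong: "(\<And>i. i < d \<Longrightarrow> a i = b i) \<Longrightarrow> hypercube d a = hypercube d b"
  unfolding hypercube_def by (rule PiE_cong) auto

lemma mem_hypercube:
  "p \<in> hypercube d a \<longleftrightarrow> p \<in> Rspace d \<and> (\<forall>i<d. a i \<le> p i \<and> p i \<le> a i + 1)"
  by (auto simp: hypercube_def Rspace_def PiE_iff)

lemma restrict_corner_mem_hypercube: "restrict a {..<d} \<in> hypercube d a"
  by (auto simp: mem_hypercube Rspace_def)

text \<open>\<open>ply\<close> is a \<open>Max\<close>, so the set of values must also be finite and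
  non-empty; the bound by 1 gives the former, a restricted corner the latter.\<close>

lemma ply_le_1:
  assumes "finite S" and "\<And>p H K. H \<in> S \<Longrightarrow> K \<in> S \<Longrightarrow> p \<in> H \<Longrightarrow> p \<in> K \<Longrightarrow> H = K"
  shows "ply d S \<le> 1"
proof -
  have le: "card {H \<in> S. p \<in> H} \<le> 1" for p
    using assms by (subst card_le_Suc0_iff_eq[unfolded One_nat_def[symmetric]]) auto
  have "finite ((\<lambda>p. card {H \<in> S. p \<in> H}) ` Rspace d)"
    by (rule finite_subset[of _ "{..1}"]) (use le in auto)
  moreover have "Rspace d \<noteq> {}"
    using restrict_corner_mem_hypercube[of undefined d] by (auto simp: mem_hypercube)
  ultimately show ?thesis
    unfolding ply_def using le by (subst Max_le_iff) auto
qed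

text \<open>Point p lies in the slab \<open>[D p i, D p i + 1]\<close> of level i; the slabs of level i subdivide a
  single cell of the previous levels, and each slab starts at one of its own points.\<close>

definition slab_system ::
    "nat \<Rightarrow> (nat \<Rightarrow> nat \<Rightarrow> real) \<Rightarrow> nat \<Rightarrow> (nat \<Rightarrow> nat \<Rightarrow> real) \<Rightarrow> bool" where
  "slab_system n x j D \<longleftrightarrow> (\<forall>i<j. \<forall>p<n.
     D p i \<le> x p i \<and> x p i \<le> D p i + 1 \<and>
     (\<forall>q<n. (\<forall>i'<i. D p i' = D q i') \<longrightarrow> D p i = D q i \<or> \<bar>D p i - D q i\<bar> > 1) \<and>
     (\<exists>q<n. (\<forall>i'\<le>i. D q i' = D p i') \<and> x q i = D p i))"

lemma slab_systemD:
  assumes "slab_system n x j D" "i < j" "p < n"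
  shows "D p i \<le> x p i" "x p i \<le> D p i + 1"
    "q < n \<Longrightarrow> (\<And>i'. i' < i \<Longrightarrow> D p i' = D q i') \<Longrightarrow> D p i \<noteq> D q i \<Longrightarrow> \<bar>D p i - D q i\<bar> > 1"
    "\<exists>q<n. (\<forall>i'\<le>i. D q i' = D p i') \<and> x q i = D p i"
  using assms unfolding slab_system_def by blast+

text \<open>Slabs of one level are comparable only inside a common cell of the earlier levels, so
  two different corners are always compared at the least index where they differ.\<close>

lemma first_difference:
  fixes f g :: "nat \<Rightarrow> 'a"
  assumes "i < d" "f i \<noteq> g i"
  obtains k where "k < d" "f k \<noteq> g k" "\<And>i. i < k \<Longrightarrow> f i = g i"
proof
  let ?k = "LEAST k. f k \<noteq> g k"
  show "f ?k \<noteq> g ?k" using assms(2) by (rule LeastI)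
  show "?k < d" using Least_le[of "\<lambda>k. f k \<noteq> g k", OF assms(2)] assms(1) by simp
  show "\<And>i. i < ?k \<Longrightarrow> f i = g i" using not_less_Least by blast
qed

text \<open>At the first level k where the corners differ, both slabs subdivide the same cell and
  start more than 1 apart, while the common point confines both starts to the unit interval ending
  at \<open>z k\<close>.\<close>

lemma slab_cells_eq:
  assumes D: "slab_system n x d D" and "p < n" "q < n"
    and z: "z \<in> hypercube d (D p)" "z \<in> hypercube d (D q)" and "i < d"
  shows "D p i = D q i"
proof (rule ccontr)
  assume "D p i \<noteq> D q i"
  with \<open>i < d\<close> obtain k where k: "k < d" "D p k \<noteq> D q k" "\<And>i. i < k \<Longrightarrow> D p i = D q i"
    by (rule first_difference) blast
  then have "\<bar>D p k - D q k\<bar> > 1" using slab_systemD(3)[OF D k(1) \<open>p < n\<close> \<open>q < n\<close>] by blast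
  then show False using z k(1) by (fastforce simp: mem_hypercube)
qed

text \<open>The corner of one cube, seen as a point of both, forces the corners to agree. This links
  the output, which must list cubes without repetition, to a program that only compares corners and
  cell numbers.\<close>

lemma slab_hypercube_eq_iff:
  assumes "slab_system n x d D" "p < n" "q < n"
  shows "hypercube d (D p) = hypercube d (D q) \<longleftrightarrow> (\<forall>i<d. D p i = D q i)"
proof
  assume eq: "hypercube d (D p) = hypercube d (D q)"
  then have "restrict (D p) {..<d} \<in> hypercube d (D q)" using restrict_corner_mem_hypercube[of "D p" d] by simp
  then show "\<forall>i<d. D p i = D q i" using slab_cells_eq[OF assms restrict_corner_mem_hypercube] by blast
qed (rule hypercube_cong, blast)

lemma slab_system_one_ply_cover:
  assumes D: "slab_system n x d D"
  shows "one_ply_cover d ((\<lambda>p. restrict (x p) {..<d}) ` {..<n}) ((\<lambda>p. hypercube d (D p)) ` {..<n})"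
    (is "one_ply_cover d ?P ?S")
  unfolding one_ply_cover_def
proof (intro conjI ballI)
  have "restrict (x p) {..<d} \<in> hypercube d (D p)" if "p < n" for p
    using slab_systemD(1,2)[OF D _ that] by (simp add: mem_hypercube Rspace_def)
  then show "?P \<subseteq> \<Union>?S" by fast
  show "unit_hypercube d H" if "H \<in> ?S" for H
    using that unfolding unit_hypercube_def by (elim imageE) (rule exI)
  show "finite ?S" by simp
  show "ply d ?S \<le> 1"
  proof (rule ply_le_1)
    fix z H K assume "H \<in> ?S" "K \<in> ?S" "z \<in> H" "z \<in> K"
    then obtain p q where pq: "p < n" "q < n" "H = hypercube d (D p)" "K = hypercube d (D q)"
      by blast
    then have "D p i = D q i" if "i < d" for i
      using \<open>z \<in> H\<close> \<open>z \<in> K\<close> pq slab_cells_eq[OF D pq(1,2) _ _ that, of z] by simp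
    then show "H = K" unfolding pq(3,4) by (rule hypercube_cong)
  qed simp
qed

text \<open>A cell is charged to a hypercube \<open>hypercube d a\<close> of the other cover that contains the point
  at which its last slab starts. In each of the remaining directions at most two slabs meet
  \<open>[a i, a i + 1]\<close>, and these are told apart by whether they start at or below \<open>a i\<close>.\<close>

lemma slab_system_card_le:
  assumes D: "slab_system n x d D" and "d \<ge> 1"
    and S': "finite S'" "\<And>H. H \<in> S' \<Longrightarrow> unit_hypercube d H"
    and cover: "(\<lambda>p. restrict (x p) {..<d}) ` {..<n} \<subseteq> \<Union>S'"
  shows "card ((\<lambda>p. hypercube d (D p)) ` {..<n}) \<le> 2 ^ (d - 1) * card S'"
proof -
  obtain a where a: "\<And>H. H \<in> S' \<Longrightarrow> H = hypercube d (a H)"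
    using S'(2) unfolding unit_hypercube_def by metis
  \<comment> \<open>The witness is a point of the cell of p at which the last slab of that cell
    starts; level \<open>d - 1\<close> is the one on which the agreement covers all
    coordinates.\<close>
  have "\<exists>q<n. (\<forall>i<d. D q i = D p i) \<and> x q (d - 1) = D p (d - 1)" if "p < n" for p
    using slab_systemD(4)[OF D _ that, of "d - 1"] \<open>d \<ge> 1\<close>
    by (metis Suc_diff_le diff_Suc_1 diff_less less_Suc_eq_le less_numeral_extra(1) less_le_trans)
  then obtain q where q: "\<And>p. p < n \<Longrightarrow> q p < n" "\<And>p i. p < n \<Longrightarrow> i < d \<Longrightarrow> D (q p) i = D p i"
      "\<And>p. p < n \<Longrightarrow> x (q p) (d - 1) = D p (d - 1)"
    by metis
  have "\<exists>H\<in>S'. restrict (x (q p)) {..<d} \<in> H" if "p < n" for p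
    using cover q(1)[OF that] by blast
  then obtain h where h: "\<And>p. p < n \<Longrightarrow> h p \<in> S'"
      "\<And>p. p < n \<Longrightarrow> restrict (x (q p)) {..<d} \<in> h p"
    by metis
  have box: "a (h p) i \<le> x (q p) i" "x (q p) i \<le> a (h p) i + 1" if "p < n" "i < d" for p i
  proof -
    have "restrict (x (q p)) {..<d} \<in> hypercube d (a (h p))" using h[OF that(1)] a by metis
    then show "a (h p) i \<le> x (q p) i" "x (q p) i \<le> a (h p) i + 1"
      using that(2) by (auto simp: mem_hypercube)
  qed
  \<comment> \<open>The key of the charging: the charged cube and, for each direction but the last,
    the side of its lower face on which the slab starts.\<close>
  define c where "c p = (h p, {i. i < d - 1 \<and> D p i \<le> a (h p) i})" for p
  have inj: "hypercube d (D p) = hypercube d (D p')" if p: "p < n" "p' < n" and c: "c p = c p'" for p p'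
  proof (rule ccontr)
    assume "hypercube d (D p) \<noteq> hypercube d (D p')"
    then obtain i where "i < d" "D p i \<noteq> D p' i" using hypercube_cong by blast
    then obtain k where k: "k < d" "D p k \<noteq> D p' k" "\<And>i. i < k \<Longrightarrow> D p i = D p' i"
      by (rule first_difference) blast
    have far: "\<bar>D p k - D p' k\<bar> > 1"
      using slab_systemD(3)[OF D k(1) p] k by blast
    have [simp]: "h p' = h p" and same: "k < d - 1 \<Longrightarrow> D p k \<le> a (h p) k \<longleftrightarrow> D p' k \<le> a (h p) k"
      using c by (auto simp: c_def)
    have near: "D r k \<le> x (q r) k" "x (q r) k \<le> D r k + 1" if "r < n" for r
      using slab_systemD(1,2)[OF D k(1) q(1)[OF that]] q(2)[OF that k(1)] by auto
    show False
    proof (cases "k < d - 1")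
      \<comment> \<open>Write a for \<open>a (h p) k\<close>. Both slabs meet
        \<open>[a, a + 1]\<close>, so their starts lie in \<open>[a - 1, a + 1]\<close>; being on
        the same side of a, they are at most 1 apart, against \<open>far\<close>.\<close>
      case True
      show ?thesis
        using same[OF True] far near[OF p(1)] near[OF p(2)] box[OF p(1) k(1)] box[OF p(2) k(1)]
        by auto
    next
      case False
      \<comment> \<open>In the last direction the starts are themselves coordinates of points in the
        charged cube, so they are at most 1 apart without any further bit in the key.\<close>
      then have "k = d - 1" using k(1) by simp
      then show ?thesis
        using far q(3)[OF p(1)] q(3)[OF p(2)] box[OF p(1) k(1)] box[OF p(2) k(1)]
        by (simp add: abs_if split: if_splits)
    qed
  qed
  have "card ((\<lambda>p. hypercube d (D p)) ` {..<n}) \<le> card (c ` {..<n})"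
  proof (rule surj_card_le)
    \<comment> \<open>The cube depends only on the key, so it can be recovered from an arbitrarily
      chosen point with that key.\<close>
    let ?f = "\<lambda>y. hypercube d (D (SOME p. p < n \<and> c p = y))"
    show "(\<lambda>p. hypercube d (D p)) ` {..<n} \<subseteq> ?f ` c ` {..<n}"
    proof clarsimp
      fix p assume "p < n"
      then have "\<exists>p'. p' < n \<and> c p' = c p" by blast
      from someI_ex[OF this] have "hypercube d (D p) = ?f (c p)" using inj \<open>p < n\<close> by metis
      then show "hypercube d (D p) \<in> ?f ` c ` {..<n}" using \<open>p < n\<close> by blast
    qed
  qed simp
  also have "\<dots> \<le> card (S' \<times> Pow {..<d - 1})"
    by (rule card_mono) (use S'(1) h(1) in \<open>auto simp: c_def\<close>)
  also have "\<dots> = 2 ^ (d - 1) * card S'"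
    by (simp add: card_cartesian_product card_Pow)
  finally show ?thesis .
qed


section \<open>Timed program logic\<close>

notation Seq (infixr ";;" 60)

section \<open>Loop-free commands: final state and cost by evaluation\<close>

primrec straight :: "com \<Rightarrow> bool" where
  "straight Skip = True"
| "straight (NSet x i e) = True"
| "straight (RSet x i e) = True"
| "straight (c1 ;; c2) = (straight c1 \<and> straight c2)"
| "straight (Cond b c1 c2) = (straight c1 \<and> straight c2)"
| "straight (While b c) = False"

primrec outcome :: "com \<Rightarrow> ram \<Rightarrow> ram" where
  "outcome Skip s = s"
| "outcome (NSet x i e) s = nupd x (nval i s) (nval e s) s"
| "outcome (RSet x i e) s = rupd x (nval i s) (rval e s) s"
| "outcome (c1 ;; c2) s = outcome c2 (outcome c1 s)"
| "outcome (Cond b c1 c2) s = (if bval b s then outcome c1 s else outcome c2 s)"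
| "outcome (While b c) s = s"

text \<open>The clauses for \<open>While\<close> here and in \<open>outcome\<close> are dummies,
  excluded by \<open>straight\<close>. A conditional is charged for both branches: cruder than the
  maximum, but a plain sum that simplifies to a numeral.\<close>

primrec max_cost :: "com \<Rightarrow> nat" where
  "max_cost Skip = 1"
| "max_cost (NSet x i e) = 1 + ncost i + ncost e"
| "max_cost (RSet x i e) = 1 + ncost i + rcost e"
| "max_cost (c1 ;; c2) = max_cost c1 + max_cost c2"
| "max_cost (Cond b c1 c2) = 1 + bcost b + (max_cost c1 + max_cost c2)"
| "max_cost (While b c) = 0"

lemma exec_straight: "straight c \<Longrightarrow> \<exists>t \<le> max_cost c. exec c s t (outcome c s)"
proof (induction c arbitrary: s)
  case (Seq c1 c2)
  then obtain t1 t2 where "t1 \<le> max_cost c1" "exec c1 s t1 (outcome c1 s)"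
    "t2 \<le> max_cost c2" "exec c2 (outcome c1 s) t2 (outcome c2 (outcome c1 s))"
    by (metis straight.simps(4))
  then show ?case by (intro exI[of _ "t1 + t2"]) (auto intro: exec.Seq)
next
  case (Cond b c1 c2)
  then obtain t1 t2 where t: "t1 \<le> max_cost c1" "exec c1 s t1 (outcome c1 s)"
    "t2 \<le> max_cost c2" "exec c2 s t2 (outcome c2 s)"
    by (metis straight.simps(5))
  show ?case
  proof (cases "bval b s")
    case True
    then show ?thesis using exec.CondTrue[OF True t(2), of c2] t
      by (intro exI[of _ "1 + bcost b + t1"]) simp
  next
    case False
    then show ?thesis using exec.CondFalse[OF False t(4), of c1] t
      by (intro exI[of _ "1 + bcost b + t2"]) simp
  qed
next
  case Skip
  show ?case using exec.Skip[of s] by (intro exI[of _ 1]) simp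
next
  case (NSet x i e)
  show ?case using exec.NSet[of x i e s] by (intro exI[of _ "1 + ncost i + ncost e"]) simp
next
  case (RSet x i e)
  show ?case using exec.RSet[of x i e s] by (intro exI[of _ "1 + ncost i + rcost e"]) simp
qed simp

primrec nwrites :: "com \<Rightarrow> vname set" where
  "nwrites Skip = {}"
| "nwrites (NSet x i e) = {x}"
| "nwrites (RSet x i e) = {}"
| "nwrites (c1 ;; c2) = nwrites c1 \<union> nwrites c2"
| "nwrites (Cond b c1 c2) = nwrites c1 \<union> nwrites c2"
| "nwrites (While b c) = nwrites c"

primrec rwrites :: "com \<Rightarrow> vname set" where
  "rwrites Skip = {}"
| "rwrites (NSet x i e) = {}"
| "rwrites (RSet x i e) = {x}"
| "rwrites (c1 ;; c2) = rwrites c1 \<union> rwrites c2"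
| "rwrites (Cond b c1 c2) = rwrites c1 \<union> rwrites c2"
| "rwrites (While b c) = rwrites c"

text \<open>Over-approximates the effect of a command by the array names in its syntax. It survives
  loops, so the preservation of untouched arrays need not be part of each invariant.\<close>

definition frame :: "com \<Rightarrow> ram \<Rightarrow> ram \<Rightarrow> bool" where
  "frame c s s' \<longleftrightarrow> (\<forall>x. x \<notin> nwrites c \<longrightarrow> nmem s' x = nmem s x) \<and>
                  (\<forall>x. x \<notin> rwrites c \<longrightarrow> rmem s' x = rmem s x)"

lemma frameD:
  assumes "frame c s s'"
  shows "x \<notin> nwrites c \<Longrightarrow> nmem s' x = nmem s x" "x \<notin> rwrites c \<Longrightarrow> rmem s' x = rmem s x"
  using assms by (auto simp: frame_def)

lemma nmem_upd [simp]:
  "nmem (nupd x i v s) = (nmem s)(x := (nmem s x)(i := v))" "nmem (rupd x i r s) = nmem s"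
  by (simp_all add: nupd_def rupd_def)

lemma rmem_upd [simp]:
  "rmem (rupd x i v s) = (rmem s)(x := (rmem s x)(i := v))" "rmem (nupd x i k s) = rmem s"
  by (simp_all add: nupd_def rupd_def)

lemma exec_frame: "exec c s t s' \<Longrightarrow> frame c s s'"
  by (induction rule: exec.induct) (auto simp: frame_def)

text \<open>Total correctness with an upper bound in place of the exact step count, so that costs
  can be rounded up to convenient numerals at every composition.\<close>

definition runs :: "com \<Rightarrow> ram \<Rightarrow> nat \<Rightarrow> (ram \<Rightarrow> bool) \<Rightarrow> bool" where
  "runs c s T Q \<longleftrightarrow> (\<exists>t s'. exec c s t s' \<and> t \<le> T \<and> Q s')"

lemma runs_conseq:
  assumes "runs c s T Q" "\<And>s'. Q s' \<Longrightarrow> frame c s s' \<Longrightarrow> Q' s'" "T \<le> T'"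
  shows "runs c s T' Q'"
  using assms exec_frame unfolding runs_def by (meson le_trans)

lemma runs_straight:
  assumes "straight c" "Q (outcome c s)" "max_cost c \<le> T"
  shows "runs c s T Q"
  using exec_straight[OF assms(1), of s] assms(2,3) unfolding runs_def by (meson le_trans)

lemma runs_Seq:
  assumes "runs c1 s T1 R" "\<And>s'. R s' \<Longrightarrow> frame c1 s s' \<Longrightarrow> runs c2 s' T2 Q" "T1 + T2 \<le> T"
  shows "runs (c1 ;; c2) s T Q"
proof -
  obtain t1 s1 where 1: "exec c1 s t1 s1" "t1 \<le> T1" "R s1" using assms(1) by (auto simp: runs_def)
  obtain t2 s2 where 2: "exec c2 s1 t2 s2" "t2 \<le> T2" "Q s2"
    using assms(2)[OF 1(3) exec_frame[OF 1(1)]] by (auto simp: runs_def)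
  show ?thesis unfolding runs_def using exec.Seq[OF 1(1) 2(1)] 1 2 assms(3)
    by (intro exI[of _ "t1 + t2"] exI[of _ s2]) auto
qed

lemma runs_straight_Seq:
  assumes "straight c1" "frame c1 s (outcome c1 s) \<Longrightarrow> runs c2 (outcome c1 s) T2 Q"
    "max_cost c1 + T2 \<le> T"
  shows "runs (c1 ;; c2) s T Q"
  by (rule runs_Seq[where R = "\<lambda>s'. s' = outcome c1 s"])
    (use assms in \<open>auto intro: runs_straight\<close>)

text \<open>All loops of the program are counted: the invariant carries the number of finished
  rounds, and N fixes both termination and cost, namely N rounds with their tests plus one failing
  test.\<close>

lemma runs_While:
  assumes I: "I 0 s"
    and body: "\<And>k s'. k < N \<Longrightarrow> I k s' \<Longrightarrow> frame c s s' \<Longrightarrow> bval b s' \<and> runs c s' B (I (Suc k))"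
    and exit: "\<And>s'. I N s' \<Longrightarrow> frame c s s' \<Longrightarrow> \<not> bval b s'"
    and post: "\<And>s'. I N s' \<Longrightarrow> frame c s s' \<Longrightarrow> Q s'"
    and T: "N * (B + 1 + bcost b) + 1 + bcost b \<le> T"
  shows "runs (While b c) s T Q"
proof -
  have "runs (While b c) s' (k * (B + 1 + bcost b) + 1 + bcost b) (I N)"
    if "I (N - k) s'" "frame c s s'" "k \<le> N" for k s'
    using that
  proof (induction k arbitrary: s')
    case 0
    then show ?case using exec.WhileFalse[of b s' c] exit by (auto simp: runs_def)
  next
    case (Suc k)
    have less: "N - Suc k < N" and eq: "Suc (N - Suc k) = N - k" using Suc.prems(3) by auto
    from body[OF less Suc.prems(1,2)] obtain t1 s1
      where 1: "bval b s'" "exec c s' t1 s1" "t1 \<le> B" "I (N - k) s1"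
      by (auto simp: runs_def eq)
    have "frame c s s1" using Suc.prems(2) exec_frame[OF 1(2)] by (auto simp: frame_def)
    with Suc.IH[OF 1(4)] Suc.prems(3) obtain t2 s2
      where 2: "exec (While b c) s1 t2 s2" "t2 \<le> k * (B + 1 + bcost b) + 1 + bcost b" "I N s2"
      by (auto simp: runs_def)
    show ?case unfolding runs_def
      using exec.WhileTrue[OF 1(1,2) 2(1)] 1(3) 2(2,3)
      by (intro exI[of _ "1 + bcost b + t1 + t2"] exI[of _ s2]) auto
  qed
  from this[of N s] I have "runs (While b c) s (N * (B + 1 + bcost b) + 1 + bcost b) (I N)"
    by (simp add: frame_def)
  then show ?thesis by (rule runs_conseq) (use T post in \<open>auto simp: frame_def\<close>)
qed

abbreviation nvar :: "vname \<Rightarrow> nexp" where "nvar x \<equiv> NGet x (NConst 0)"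
abbreviation nassign :: "vname \<Rightarrow> nexp \<Rightarrow> com" where "nassign x e \<equiv> NSet x (NConst 0) e"
abbreviation incr :: "vname \<Rightarrow> com" where "incr x \<equiv> nassign x (NAdd (nvar x) (NConst 1))"


section \<open>Merge sort\<close>

definition key_le :: "(nat \<Rightarrow> nat) \<Rightarrow> (nat \<Rightarrow> real) \<Rightarrow> nat \<Rightarrow> nat \<Rightarrow> bool" where
  "key_le g y p q \<longleftrightarrow> g p < g q \<or> g p = g q \<and> y p \<le> y q"

lemma key_le_trans: "key_le g y p q \<Longrightarrow> key_le g y q r \<Longrightarrow> key_le g y p r"
  by (auto simp: key_le_def)

lemma key_le_total: "key_le g y p q \<or> key_le g y q p"
  by (auto simp: key_le_def)

text \<open>Blocks start at multiples of w and the last one is cut off at n. This is the shape of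
  bottom-up merge sort, chosen because commands have no recursion.\<close>

definition blocks_sorted :: "(nat \<Rightarrow> nat \<Rightarrow> bool) \<Rightarrow> nat \<Rightarrow> nat \<Rightarrow> (nat \<Rightarrow> nat) \<Rightarrow> bool" where
  "blocks_sorted le n w A \<longleftrightarrow>
     (\<forall>q x y. q * w \<le> x \<longrightarrow> x < y \<longrightarrow> y < q * w + w \<longrightarrow> y < n \<longrightarrow> le (A x) (A y))"

lemma blocks_sortedD:
  "blocks_sorted le n w A \<Longrightarrow> q * w \<le> x \<Longrightarrow> x < y \<Longrightarrow> y < q * w + w \<Longrightarrow> y < n \<Longrightarrow> le (A x) (A y)"
  unfolding blocks_sorted_def by blast

lemma blocks_sorted_cong:
  assumes "\<And>i. i < n \<Longrightarrow> A i = B i"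
  shows "blocks_sorted le n w A \<longleftrightarrow> blocks_sorted le n w B"
  unfolding blocks_sorted_def using assms by (metis less_trans)

text \<open>The blocks \<open>{lo..<mid}\<close> and \<open>{mid..<hi}\<close> of A, cut off at n, are being merged into B; the
  next entries to be read from them are a and b, and k entries of B have been written.\<close>

definition merging :: "(nat \<Rightarrow> nat \<Rightarrow> bool) \<Rightarrow> nat \<Rightarrow> nat \<Rightarrow> (nat \<Rightarrow> nat) \<Rightarrow>
    nat \<Rightarrow> nat \<Rightarrow> nat \<Rightarrow> nat \<Rightarrow> nat \<Rightarrow> nat \<Rightarrow> (nat \<Rightarrow> nat) \<Rightarrow> bool" where
  "merging le n w A lo k a mid b hi B \<longleftrightarrow>
     2 * w dvd lo \<and> 2 * w dvd hi \<and> (lo = hi \<or> mid = lo + w \<and> hi = mid + w) \<and>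
     lo \<le> a \<and> a \<le> mid \<and> mid \<le> b \<and> b \<le> hi \<and> (b = mid \<or> b \<le> n) \<and> k + mid = a + b \<and>
     B ` {..<k} = A ` ({..<a} \<union> {mid..<b}) \<and>
     blocks_sorted le k (2 * w) B \<and>
     (\<forall>x. lo \<le> x \<longrightarrow> x < k \<longrightarrow>
        (a < mid \<longrightarrow> a < n \<longrightarrow> le (B x) (A a)) \<and> (b < hi \<longrightarrow> b < n \<longrightarrow> le (B x) (A b)))"

lemma mergingD:
  assumes "merging le n w A lo k a mid b hi B"
  shows "2 * w dvd lo" "2 * w dvd hi" "lo = hi \<or> mid = lo + w \<and> hi = mid + w"
    "lo \<le> a" "a \<le> mid" "mid \<le> b" "b \<le> hi" "b = mid \<or> b \<le> n" "k + mid = a + b"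
    "B ` {..<k} = A ` ({..<a} \<union> {mid..<b})" "blocks_sorted le k (2 * w) B"
    "lo \<le> x \<Longrightarrow> x < k \<Longrightarrow> a < mid \<Longrightarrow> a < n \<Longrightarrow> le (B x) (A a)"
    "lo \<le> x \<Longrightarrow> x < k \<Longrightarrow> b < hi \<Longrightarrow> b < n \<Longrightarrow> le (B x) (A b)"
  using assms unfolding merging_def by blast+

text \<open>Reaching \<open>hi\<close> forces both runs to be used up, so B holds all of A below k.
  The new bounds are not cut at n: \<open>mid\<close> may exceed n, which is why the invariant
  permits \<open>b = mid\<close> besides \<open>b \<le> n\<close>. Its alternative
  \<open>lo = hi\<close> admits the start with all indices 0.\<close>

lemma merging_next_block:
  assumes "merging le n w A lo k a mid b hi B" "\<not> k < hi"
  shows "merging le n w A k k k (k + w) (k + w) (k + w + w) B"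
proof -
  note M = mergingD[OF assms(1)]
  have eq: "k = hi" "a = mid" "b = hi" using M(3-9) assms(2) by linarith+
  have "{..<mid} \<union> {mid..<hi} = {..<hi}" using M(5-7) eq by auto
  then have "B ` {..<k} = A ` {..<k}" using M(10) eq by simp
  moreover have "2 * w dvd k + w + w"
    using M(2) eq dvd_add[of "2 * w" k "2 * w"] by (simp add: mult_2 add.assoc)
  ultimately show ?thesis using M(2,11) eq(1) unfolding merging_def by simp
qed

lemma block_index: "q * v \<le> k \<Longrightarrow> k < q * v + v \<Longrightarrow> k div v = q" for k q v :: nat
  by (rule div_nat_eqI) (simp_all add: ac_simps)

text \<open>Appending z creates new pairs only in the block that contains k, and that block starts
  at \<open>lo\<close>.\<close>

lemma blocks_sorted_extend:
  assumes "blocks_sorted le k v B" "lo = q * v" "lo \<le> k" "k < lo + v"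
    and "\<And>x. lo \<le> x \<Longrightarrow> x < k \<Longrightarrow> le (B x) z"
  shows "blocks_sorted le (Suc k) v (B(k := z))"
  unfolding blocks_sorted_def
proof (intro allI impI)
  fix r x y assume xy: "r * v \<le> x" "x < y" "y < r * v + v" "y < Suc k"
  show "le ((B(k := z)) x) ((B(k := z)) y)"
  proof (cases "y = k")
    case True
    have "k div v = r" by (rule block_index) (use xy True in simp_all)
    moreover have "k div v = q" by (rule block_index) (use assms(2-4) in simp_all)
    ultimately show ?thesis using assms(2,5) xy True by simp
  next
    case False
    then show ?thesis using assms(1) xy unfolding blocks_sorted_def by auto
  qed
qed

lemma blocks_sorted_adjacent:
  assumes "blocks_sorted le n w A" "lo = q * w" "lo \<le> a" "Suc a < lo + w" "Suc a < n"
  shows "le (A a) (A (Suc a))"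
  using assms unfolding blocks_sorted_def by blast

lemma merging_step_left:
  assumes M: "merging le n w A lo k a mid b hi B" and k: "k < hi" "k < n" and "a < mid"
    and A: "blocks_sorted le n w A" and trans: "\<And>p q r. le p q \<Longrightarrow> le q r \<Longrightarrow> le p r"
    and le: "b < hi \<Longrightarrow> b < n \<Longrightarrow> le (A a) (A b)"
  shows "merging le n w A lo (Suc k) (Suc a) mid b hi (B(k := A a))"
proof -
  note D = mergingD[OF M]
  \<comment> \<open>From \<open>k + mid = a + b\<close> and \<open>mid \<le> b\<close> follows
    \<open>a \<le> k\<close>, hence \<open>a < n\<close>.\<close>
  have bound: "a < mid" "a < n" using D(6,9) k \<open>a < mid\<close> by linarith+
  obtain q where q: "lo = q * (2 * w)" using D(1) by (auto simp: dvd_def mult.commute)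
  have blk: "mid = lo + w" "hi = mid + w" "lo \<le> k" "k < lo + 2 * w"
    using D(3-9) k bound by linarith+
  \<comment> \<open>The left run is block number \<open>2 * q\<close> of width w; the right run is
    block \<open>2 * q + 1\<close>.\<close>
  have start: "lo = q * 2 * w" using q blk by simp
  have next_le: "le (A a) (A (Suc a))" if "Suc a < mid" "Suc a < n"
    by (rule blocks_sorted_adjacent[OF A start]) (use that blk D(4) in linarith)+
  have old: "le (B x) (A a)" if "lo \<le> x" "x < k" for x
    using D(12)[OF that bound] .
  have sorted: "blocks_sorted le (Suc k) (2 * w) (B(k := A a))"
    using blocks_sorted_extend[OF D(11) q blk(3,4) old] .
  have eq: "{..<Suc a} \<union> {mid..<b} = insert a ({..<a} \<union> {mid..<b})" by auto
  have image: "(B(k := A a)) ` {..<Suc k} = A ` ({..<Suc a} \<union> {mid..<b})"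
  proof -
    have "(B(k := A a)) ` {..<Suc k} = insert (A a) (B ` {..<k})" by (auto simp: lessThan_Suc)
    then show ?thesis using D(10) eq by simp
  qed
  have le_a: "le ((B(k := A a)) x) (A (Suc a))"
    if "lo \<le> x" "x < Suc k" "Suc a < mid" "Suc a < n" for x
  proof (cases "x = k")
    case False
    then have "x < k" using that(2) by simp
    then show ?thesis using trans[OF old[OF that(1)] next_le[OF that(3,4)]] by simp
  qed (use next_le that in simp)
  have le_b: "le ((B(k := A a)) x) (A b)"
    if "lo \<le> x" "x < Suc k" "b < hi" "b < n" for x
  proof (cases "x = k")
    case False
    then show ?thesis using D(13)[OF that(1) _ that(3,4)] that(2) by simp
  qed (use le that in simp)
  show ?thesis
    unfolding merging_def using D(1,2,4-9) blk(1,2) bound sorted image le_a le_b by simp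
qed

lemma merging_step_right:
  assumes M: "merging le n w A lo k a mid b hi B" and k: "k < hi" "k < n"
    and A: "blocks_sorted le n w A" and trans: "\<And>p q r. le p q \<Longrightarrow> le q r \<Longrightarrow> le p r"
    and le: "a < mid \<Longrightarrow> b < hi \<and> b < n \<and> le (A b) (A a)"
  shows "merging le n w A lo (Suc k) a mid (Suc b) hi (B(k := A b))"
proof -
  note D = mergingD[OF M]
  \<comment> \<open>Once the left run is used up, \<open>a = mid\<close> and therefore
    \<open>b = k\<close>, which lies below \<open>hi\<close> and n.\<close>
  have bound: "b < hi" "b < n"
    using D(5,9) k le by (cases "a < mid"; linarith)+
  obtain q where q: "lo = q * (2 * w)" using D(1) by (auto simp: dvd_def mult.commute)
  have blk: "mid = lo + w" "hi = mid + w" "lo \<le> k" "k < lo + 2 * w"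
    using D(3-9) k bound by linarith+
  have start: "mid = Suc (q * 2) * w" using q blk by simp
  have next_le: "le (A b) (A (Suc b))" if "Suc b < hi" "Suc b < n"
    by (rule blocks_sorted_adjacent[OF A start]) (use that blk D(6) in linarith)+
  have old: "le (B x) (A b)" if "lo \<le> x" "x < k" for x
    using D(13)[OF that bound] .
  have sorted: "blocks_sorted le (Suc k) (2 * w) (B(k := A b))"
    using blocks_sorted_extend[OF D(11) q blk(3,4) old] .
  have eq: "{..<a} \<union> {mid..<Suc b} = insert b ({..<a} \<union> {mid..<b})" using D(6) by auto
  have image: "(B(k := A b)) ` {..<Suc k} = A ` ({..<a} \<union> {mid..<Suc b})"
  proof -
    have "(B(k := A b)) ` {..<Suc k} = insert (A b) (B ` {..<k})" by (auto simp: lessThan_Suc)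
    then show ?thesis using D(10) eq by simp
  qed
  have le_b: "le ((B(k := A b)) x) (A (Suc b))"
    if "lo \<le> x" "x < Suc k" "Suc b < hi" "Suc b < n" for x
  proof (cases "x = k")
    case False
    then have "x < k" using that(2) by simp
    then show ?thesis using trans[OF old[OF that(1)] next_le[OF that(3,4)]] by simp
  qed (use next_le that in simp)
  have le_a: "le ((B(k := A b)) x) (A a)"
    if "lo \<le> x" "x < Suc k" "a < mid" "a < n" for x
  proof (cases "x = k")
    case False
    then show ?thesis using D(12)[OF that(1) _ that(3,4)] that(2) by simp
  qed (use le that in simp)
  show ?thesis
    unfolding merging_def using D(1,2,4-9) blk(1,2) bound sorted image le_a le_b by simp
qed

text \<open>With n entries written, either the right run is untouched and \<open>a = n\<close>, or
  \<open>a = mid\<close> and \<open>b = n\<close>; both ways exactly the first n entries have been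
  read.\<close>

lemma merging_finished:
  assumes "merging le n w A lo n a mid b hi B"
  shows "B ` {..<n} = A ` {..<n}" "blocks_sorted le n (2 * w) B"
proof -
  note D = mergingD[OF assms]
  have "{..<a} \<union> {mid..<b} = {..<n}"
  proof (cases "b = mid")
    case False
    then have "a = mid" "b = n" using D(5-9) by linarith+
    then show ?thesis using D(6) by auto
  qed (use D(9) in auto)
  then show "B ` {..<n} = A ` {..<n}" using D(10) by simp
qed (rule mergingD(11)[OF assms])

section \<open>The merge pass on the machine\<close>

definition coord :: "nexp \<Rightarrow> rexp" where
  "coord p = RGet ''P'' (NAdd (NGet ''off'' p) (nvar ''j''))"

text \<open>A strict lexicographic test; its disjunction is spelled by de Morgan because
  \<open>bexp\<close> has none.\<close>

definition before :: "nexp \<Rightarrow> nexp \<Rightarrow> bexp" where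
  "before p q = BNot (BAnd (BNot (NLess (NGet ''G'' p) (NGet ''G'' q)))
     (BNot (BAnd (BNot (NLess (NGet ''G'' q) (NGet ''G'' p))) (RLess (coord p) (coord q)))))"

definition point_key :: "ram \<Rightarrow> nat \<Rightarrow> real" where
  "point_key s p = rmem s ''P'' (nmem s ''off'' p + nmem s ''j'' 0)"

abbreviation level_le :: "ram \<Rightarrow> nat \<Rightarrow> nat \<Rightarrow> bool" where
  "level_le s \<equiv> key_le (nmem s ''G'') (point_key s)"

lemma bval_before: "bval (before p q) s \<longleftrightarrow> \<not> level_le s (nval q s) (nval p s)"
  by (auto simp: before_def coord_def key_le_def point_key_def)

definition start_block :: com where
  "start_block = Cond (NLess (nvar ''k'') (nvar ''hi'')) Skip
     (nassign ''a'' (nvar ''k'') ;; nassign ''mid'' (NAdd (nvar ''k'') (nvar ''w'')) ;;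
      nassign ''b'' (nvar ''mid'') ;; nassign ''hi'' (NAdd (nvar ''mid'') (nvar ''w'')))"

text \<open>Conjunctions are evaluated in full, but reading past the end of a run is harmless
  because memory is total; the tests \<open>b < hi\<close> and \<open>b < n\<close> discard what was
  read there.\<close>

definition take_next :: com where
  "take_next = Cond (BAnd (NLess (nvar ''a'') (nvar ''mid''))
       (BNot (BAnd (NLess (nvar ''b'') (nvar ''hi'')) (BAnd (NLess (nvar ''b'') (nvar ''n''))
          (before (NGet ''A'' (nvar ''b'')) (NGet ''A'' (nvar ''a'')))))))
     (NSet ''B'' (nvar ''k'') (NGet ''A'' (nvar ''a'')) ;; incr ''a'')
     (NSet ''B'' (nvar ''k'') (NGet ''A'' (nvar ''b'')) ;; incr ''b'') ;; incr ''k''"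

definition merging_state ::
    "(nat \<Rightarrow> nat \<Rightarrow> bool) \<Rightarrow> nat \<Rightarrow> nat \<Rightarrow> (nat \<Rightarrow> nat) \<Rightarrow> nat \<Rightarrow> ram \<Rightarrow> bool" where
  "merging_state le n w A k s \<longleftrightarrow> nmem s ''k'' 0 = k \<and>
     (\<exists>lo. merging le n w A lo k (nmem s ''a'' 0) (nmem s ''mid'' 0) (nmem s ''b'' 0)
        (nmem s ''hi'' 0) (nmem s ''B''))"

lemma start_block:
  assumes "merging_state le n w A k s" "w > 0" "nmem s ''w'' 0 = w"
  shows "merging_state le n w A k (outcome start_block s)"
    "k < nmem (outcome start_block s) ''hi'' 0"
proof -
  have k: "nmem s ''k'' 0 = k" using assms by (simp add: merging_state_def)
  obtain lo where lo: "merging le n w A lo k (nmem s ''a'' 0) (nmem s ''mid'' 0) (nmem s ''b'' 0)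
        (nmem s ''hi'' 0) (nmem s ''B'')" using assms by (auto simp: merging_state_def)
  show "merging_state le n w A k (outcome start_block s)"
  proof (cases "k < nmem s ''hi'' 0")
    case True
    then show ?thesis using assms k by (simp add: start_block_def)
  next
    case False
    from merging_next_block[OF lo False] show ?thesis using False k assms(3)
      by (auto simp: start_block_def merging_state_def)
  qed
  show "k < nmem (outcome start_block s) ''hi'' 0"
    using k assms by (auto simp: start_block_def)
qed

lemma take_next:
  assumes "merging_state (level_le s) n w (nmem s ''A'') k s" "k < n" "k < nmem s ''hi'' 0"
    "nmem s ''n'' 0 = n" "blocks_sorted (level_le s) n w (nmem s ''A'')"
  shows "merging_state (level_le s) n w (nmem s ''A'') (Suc k) (outcome take_next s)"
proof -
  let ?a = "nmem s ''a'' 0" and ?mid = "nmem s ''mid'' 0" and ?b = "nmem s ''b'' 0"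
  let ?hi = "nmem s ''hi'' 0" and ?A = "nmem s ''A''"
  have k: "nmem s ''k'' 0 = k" using assms by (simp add: merging_state_def)
  obtain lo where lo: "merging (level_le s) n w ?A lo k ?a ?mid ?b ?hi (nmem s ''B'')"
    using assms by (auto simp: merging_state_def)
  show ?thesis
  proof (cases "?a < ?mid \<and> \<not> (?b < ?hi \<and> ?b < n \<and> \<not> level_le s (?A ?a) (?A ?b))")
    case True
    have "merging (level_le s) n w ?A lo (Suc k) (Suc ?a) ?mid ?b ?hi ((nmem s ''B'')(k := ?A ?a))"
      by (rule merging_step_left[OF lo assms(3,2) _ assms(5) key_le_trans]) (use True in auto)
    then show ?thesis using True k assms(4)
      by (auto simp: take_next_def merging_state_def bval_before)
  next
    case False
    have "?b < ?hi \<and> ?b < n \<and> level_le s (?A ?b) (?A ?a)" if "?a < ?mid"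
      using False that key_le_total by blast
    then have "merging (level_le s) n w ?A lo (Suc k) ?a ?mid (Suc ?b) ?hi ((nmem s ''B'')(k := ?A ?b))"
      using key_le_trans by (intro merging_step_right[OF lo assms(3,2,5)]) blast+
    then show ?thesis using False k assms(4)
      by (auto simp: take_next_def merging_state_def bval_before)
  qed
qed

text \<open>Opening the next pair of runs is a constant-time test inside the loop over output
  positions. A pass is thus a single loop of n rounds, with no nested loops to sum up.\<close>

definition merge_blocks :: com where
  "merge_blocks =
     (nassign ''k'' (NConst 0) ;; nassign ''a'' (NConst 0) ;; nassign ''mid'' (NConst 0) ;;
      nassign ''b'' (NConst 0) ;; nassign ''hi'' (NConst 0)) ;;
     While (NLess (nvar ''k'') (nvar ''n'')) (start_block ;; take_next)"

text \<open>The order is computed from these four arrays alone, so all merge passes of one level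
  sort by one fixed order.\<close>

lemma level_le_frame:
  assumes "frame c s s'" "''G'' \<notin> nwrites c" "''off'' \<notin> nwrites c" "''j'' \<notin> nwrites c" "''P'' \<notin> rwrites c"
  shows "level_le s' = level_le s"
  using frameD[OF assms(1)] assms(2-) by (simp add: point_key_def fun_eq_iff key_le_def)

lemma merge_blocks:
  assumes "nmem s ''n'' 0 = n" "nmem s ''w'' 0 = w" "w > 0"
    "blocks_sorted (level_le s) n w (nmem s ''A'')"
  shows "runs merge_blocks s (200 * n + 200) (\<lambda>s'.
    nmem s' ''B'' ` {..<n} = nmem s ''A'' ` {..<n} \<and> blocks_sorted (level_le s) n (2 * w) (nmem s' ''B''))"
  unfolding merge_blocks_def
proof (rule runs_straight_Seq)
  let ?c = "nassign ''k'' (NConst 0) ;; nassign ''a'' (NConst 0) ;; nassign ''mid'' (NConst 0) ;;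
      nassign ''b'' (NConst 0) ;; nassign ''hi'' (NConst 0)"
  let ?b = "start_block ;; take_next"
  let ?I = "\<lambda>k. merging_state (level_le s) n w (nmem s ''A'') k"
  assume fr0: "frame ?c s (outcome ?c s)"
  have writes: "nwrites ?b = {''a'', ''mid'', ''b'', ''hi'', ''k'', ''B''}" "rwrites ?b = {}"
    by (auto simp: start_block_def take_next_def)
  show "runs (While (NLess (nvar ''k'') (nvar ''n'')) ?b) (outcome ?c s) (150 * n + 150) (\<lambda>s'.
    nmem s' ''B'' ` {..<n} = nmem s ''A'' ` {..<n} \<and> blocks_sorted (level_le s) n (2 * w) (nmem s' ''B''))"
  proof (rule runs_While[where I = ?I and N = n])
    have "merging (level_le s) n w (nmem s ''A'') 0 0 0 0 0 0 (nmem s ''B'')"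
      by (simp add: merging_def blocks_sorted_def)
    then show "?I 0 (outcome ?c s)"
      unfolding merging_state_def by (intro conjI exI[of _ 0]) simp_all
    fix k s' assume "k < n" and I: "?I k s'" and fr: "frame ?b (outcome ?c s) s'"
    have k: "nmem s' ''k'' 0 = k" using I by (simp add: merging_state_def)
    have same: "nmem s' ''A'' = nmem s ''A''" "nmem s' ''w'' 0 = w" "nmem s' ''n'' 0 = n"
      "level_le s' = level_le s"
      using frameD[OF fr, unfolded writes] assms
      by (simp_all add: point_key_def fun_eq_iff key_le_def)
    let ?s1 = "outcome start_block s'"
    have fr1: "frame start_block s' ?s1"
      using exec_straight[of start_block s'] exec_frame by (auto simp: start_block_def)
    have same1: "nmem ?s1 ''A'' = nmem s ''A''" "nmem ?s1 ''n'' 0 = n" "level_le ?s1 = level_le s"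
      using frameD[OF fr1] same level_le_frame[OF fr1] by (simp_all add: start_block_def)
    note 1 = start_block[OF I \<open>w > 0\<close> same(2)]
    have "?I (Suc k) (outcome ?b s')"
      using take_next[of ?s1 n w k] 1 \<open>k < n\<close> same1 assms(4) by simp
    then have "runs ?b s' 140 (?I (Suc k))"
      by (intro runs_straight) (auto simp: start_block_def take_next_def before_def coord_def)
    then show "bval (NLess (nvar ''k'') (nvar ''n'')) s' \<and> runs ?b s' 140 (?I (Suc k))"
      using k same(3) \<open>k < n\<close> by simp
  next
    fix s' assume I: "?I n s'" and fr: "frame ?b (outcome ?c s) s'"
    show "\<not> bval (NLess (nvar ''k'') (nvar ''n'')) s'"
      using I frameD[OF fr, unfolded writes] assms by (simp add: merging_state_def)
  next
    fix s' assume "?I n s'"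
    then obtain lo where "merging (level_le s) n w (nmem s ''A'') lo n (nmem s' ''a'' 0)
        (nmem s' ''mid'' 0) (nmem s' ''b'' 0) (nmem s' ''hi'' 0) (nmem s' ''B'')"
      unfolding merging_state_def by blast
    from merging_finished[OF this]
    show "nmem s' ''B'' ` {..<n} = nmem s ''A'' ` {..<n} \<and>
        blocks_sorted (level_le s) n (2 * w) (nmem s' ''B'')" ..
  qed simp_all
qed simp_all

definition copy_back :: com where
  "copy_back = nassign ''k'' (NConst 0) ;; While (NLess (nvar ''k'') (nvar ''n''))
     (NSet ''A'' (nvar ''k'') (NGet ''B'' (nvar ''k'')) ;; incr ''k'')"

lemma copy_back:
  assumes "nmem s ''n'' 0 = n"
  shows "runs copy_back s (50 * n + 50) (\<lambda>s'. \<forall>i<n. nmem s' ''A'' i = nmem s ''B'' i)"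
  unfolding copy_back_def
proof (rule runs_straight_Seq)
  let ?s = "outcome (nassign ''k'' (NConst 0)) s"
  let ?b = "NSet ''A'' (nvar ''k'') (NGet ''B'' (nvar ''k'')) ;; incr ''k''"
  let ?I = "\<lambda>k s'. nmem s' ''k'' 0 = k \<and> (\<forall>i<k. nmem s' ''A'' i = nmem s ''B'' i)"
  show "runs (While (NLess (nvar ''k'') (nvar ''n'')) ?b) ?s (40 * n + 40)
      (\<lambda>s'. \<forall>i<n. nmem s' ''A'' i = nmem s ''B'' i)"
  proof (rule runs_While[where I = ?I and N = n])
    fix k s' assume I: "k < n" "?I k s'" and fr: "frame ?b ?s s'"
    have same: "nmem s' ''B'' = nmem s ''B''" "nmem s' ''n'' 0 = n"
      using frameD[OF fr] assms by simp_all
    have "runs ?b s' 20 (?I (Suc k))"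
      by (intro runs_straight) (use I same in \<open>auto simp: less_Suc_eq\<close>)
    then show "bval (NLess (nvar ''k'') (nvar ''n'')) s' \<and> runs ?b s' 20 (?I (Suc k))"
      using I same by simp
  next
    fix s' assume I: "?I n s'" and fr: "frame ?b ?s s'"
    then show "\<not> bval (NLess (nvar ''k'') (nvar ''n'')) s'"
      using frameD[OF fr] assms by simp
  qed auto
qed simp_all

text \<open>For positive n this is \<open>log 2 n\<close> rounded up: how often the block width 1
  must be doubled to reach n.\<close>

definition passes :: "nat \<Rightarrow> nat" where
  "passes n = (LEAST r. n \<le> 2 ^ r)"

lemma le_two_power_passes: "n \<le> 2 ^ passes n"
  unfolding passes_def by (rule LeastI[of _ n]) (simp add: less_imp_le)

lemma two_power_less: "r < passes n \<Longrightarrow> 2 ^ r < n"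
  unfolding passes_def using not_less_Least by (metis not_le)

definition sort_points :: com where
  "sort_points = nassign ''w'' (NConst 1) ;; While (NLess (nvar ''w'') (nvar ''n''))
     (merge_blocks ;; copy_back ;; nassign ''w'' (NAdd (nvar ''w'') (nvar ''w'')))"

text \<open>Only the set of entries is tracked. That no entry gets duplicated is recovered later by
  counting, as \<open>A\<close> enumerates \<open>{..<n}\<close>.\<close>

lemma sort_points:
  assumes "nmem s ''n'' 0 = n"
  shows "runs sort_points s (passes n * (250 * n + 300) + 20) (\<lambda>s'.
    nmem s' ''A'' ` {..<n} = nmem s ''A'' ` {..<n} \<and>
    (\<forall>x y. x < y \<longrightarrow> y < n \<longrightarrow> level_le s (nmem s' ''A'' x) (nmem s' ''A'' y)))"
  unfolding sort_points_def
proof (rule runs_straight_Seq)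
  let ?s = "outcome (nassign ''w'' (NConst 1)) s"
  let ?b = "merge_blocks ;; copy_back ;; nassign ''w'' (NAdd (nvar ''w'') (nvar ''w''))"
  let ?I = "\<lambda>r s'. nmem s' ''w'' 0 = 2 ^ r \<and> nmem s' ''A'' ` {..<n} = nmem s ''A'' ` {..<n} \<and>
    blocks_sorted (level_le s) n (2 ^ r) (nmem s' ''A'')"
  have writes_merge: "nwrites merge_blocks = {''k'', ''a'', ''mid'', ''b'', ''hi'', ''B''}"
      "rwrites merge_blocks = {}"
    and writes_copy: "nwrites copy_back = {''k'', ''A''}" "rwrites copy_back = {}"
    by (auto simp: merge_blocks_def start_block_def take_next_def copy_back_def)
  show "runs (While (NLess (nvar ''w'') (nvar ''n'')) ?b) ?s (passes n * (250 * n + 300) + 10) (\<lambda>s'.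
    nmem s' ''A'' ` {..<n} = nmem s ''A'' ` {..<n} \<and>
    (\<forall>x y. x < y \<longrightarrow> y < n \<longrightarrow> level_le s (nmem s' ''A'' x) (nmem s' ''A'' y)))"
  proof (rule runs_While[where I = ?I and N = "passes n"])
    show "?I 0 ?s" by (simp add: blocks_sorted_def)
  next
    fix r s' assume r: "r < passes n" and I: "?I r s'" and fr: "frame ?b ?s s'"
    have same: "nmem s' ''n'' 0 = n" "level_le s' = level_le s"
      using frameD[OF fr] assms
      by (simp_all add: point_key_def fun_eq_iff key_le_def writes_merge writes_copy)
    have "runs ?b s' (250 * n + 280) (?I (Suc r))"
    proof (rule runs_Seq[OF merge_blocks])
      fix s1 assume s1: "nmem s1 ''B'' ` {..<n} = nmem s' ''A'' ` {..<n} \<and>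
          blocks_sorted (level_le s') n (2 * 2 ^ r) (nmem s1 ''B'')" and fr1: "frame merge_blocks s' s1"
      have same1: "nmem s1 ''n'' 0 = n" "nmem s1 ''w'' 0 = 2 ^ r"
        using frameD[OF fr1] same I by (simp_all add: writes_merge)
      show "runs (copy_back ;; nassign ''w'' (NAdd (nvar ''w'') (nvar ''w''))) s1 (50 * n + 80) (?I (Suc r))"
      proof (rule runs_Seq[OF copy_back[OF same1(1)]])
        fix s2 assume s2: "\<forall>i<n. nmem s2 ''A'' i = nmem s1 ''B'' i" and fr2: "frame copy_back s1 s2"
        have "nmem s2 ''w'' 0 = 2 ^ r"
          using frameD[OF fr2] same1 by (simp add: writes_copy)
        moreover have "nmem s2 ''A'' ` {..<n} = nmem s1 ''B'' ` {..<n}"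
          by (rule image_cong) (use s2 in auto)
        moreover have "blocks_sorted (level_le s) n (2 * 2 ^ r) (nmem s2 ''A'')"
          using blocks_sorted_cong[of n "nmem s2 ''A''" "nmem s1 ''B''"] s1 s2 same(2) by simp
        ultimately show "runs (nassign ''w'' (NAdd (nvar ''w'') (nvar ''w''))) s2 20 (?I (Suc r))"
          using s1 I by (intro runs_straight) simp_all
      qed simp
    qed (use I same in auto)
    then show "bval (NLess (nvar ''w'') (nvar ''n'')) s' \<and> runs ?b s' (250 * n + 280) (?I (Suc r))"
      using I same two_power_less[OF r] by simp
  next
    fix s' assume I: "?I (passes n) s'" and fr: "frame ?b ?s s'"
    then show "\<not> bval (NLess (nvar ''w'') (nvar ''n'')) s'"
      using frameD[OF fr] assms le_two_power_passes[of n] by (simp add: writes_merge writes_copy)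
  next
    fix s' assume I: "?I (passes n) s'"
    \<comment> \<open>Once the width has reached n, block number 0 contains all positions.\<close>
    have "level_le s (nmem s' ''A'' x) (nmem s' ''A'' y)" if "x < y" "y < n" for x y
      using I that less_le_trans[OF that(2) le_two_power_passes]
        blocks_sortedD[of "level_le s" n "2 ^ passes n" _ 0 x y] by simp
    then show "nmem s' ''A'' ` {..<n} = nmem s ''A'' ` {..<n} \<and>
      (\<forall>x y. x < y \<longrightarrow> y < n \<longrightarrow> level_le s (nmem s' ''A'' x) (nmem s' ''A'' y))"
      using I by blast
  next
    show "passes n * (250 * n + 280 + 1 + bcost (NLess (nvar ''w'') (nvar ''n''))) + 1
      + bcost (NLess (nvar ''w'') (nvar ''n'')) \<le> passes n * (250 * n + 300) + 10"
      by (simp add: algebra_simps)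
  qed
qed simp_all

section \<open>Slabs of one level\<close>

text \<open>The points in R have been scanned in the order of \<open>key_le g y\<close>, where g numbers the cells of
  the previous levels: G numbers the m new cells, E gives their slabs, and the last cell opened
  belongs to the old cell c and starts at z.\<close>

definition scanned :: "(nat \<Rightarrow> nat) \<Rightarrow> (nat \<Rightarrow> real) \<Rightarrow> nat set \<Rightarrow> nat \<Rightarrow> nat \<Rightarrow> real \<Rightarrow>
    (nat \<Rightarrow> nat) \<Rightarrow> (nat \<Rightarrow> real) \<Rightarrow> bool" where
  "scanned g y R m c z G E \<longleftrightarrow>
     (\<forall>p. p \<notin> R \<longrightarrow> G p = g p) \<and> G ` R = {..<m} \<and>
     (\<forall>p\<in>R. E p \<le> y p \<and> y p \<le> E p + 1 \<and> (\<exists>q\<in>R. G q = G p \<and> y q = E p) \<and>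
        (g p < c \<or> g p = c \<and> E p \<le> z)) \<and>
     (\<forall>p\<in>R. \<forall>q\<in>R. (G p = G q \<longleftrightarrow> g p = g q \<and> E p = E q) \<and>
        (g p = g q \<longrightarrow> E p = E q \<or> \<bar>E p - E q\<bar> > 1)) \<and>
     (0 < m \<longrightarrow> (\<exists>p\<in>R. G p = m - 1 \<and> g p = c \<and> E p = z))"

lemma scannedD:
  assumes "scanned g y R m c z G E"
  shows "p \<notin> R \<Longrightarrow> G p = g p" "G ` R = {..<m}"
    "p \<in> R \<Longrightarrow> E p \<le> y p" "p \<in> R \<Longrightarrow> y p \<le> E p + 1"
    "p \<in> R \<Longrightarrow> \<exists>q\<in>R. G q = G p \<and> y q = E p"
    "p \<in> R \<Longrightarrow> g p < c \<or> g p = c \<and> E p \<le> z"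
    "p \<in> R \<Longrightarrow> q \<in> R \<Longrightarrow> G p = G q \<longleftrightarrow> g p = g q \<and> E p = E q"
    "p \<in> R \<Longrightarrow> q \<in> R \<Longrightarrow> g p = g q \<Longrightarrow> E p \<noteq> E q \<Longrightarrow> \<bar>E p - E q\<bar> > 1"
    "0 < m \<Longrightarrow> \<exists>p\<in>R. G p = m - 1 \<and> g p = c \<and> E p = z"
proof -
  have 1: "\<forall>p. p \<notin> R \<longrightarrow> G p = g p" and 2: "G ` R = {..<m}"
    and 3: "\<forall>p\<in>R. E p \<le> y p \<and> y p \<le> E p + 1 \<and> (\<exists>q\<in>R. G q = G p \<and> y q = E p) \<and>
        (g p < c \<or> g p = c \<and> E p \<le> z)"
    and 4: "\<forall>p\<in>R. \<forall>q\<in>R. (G p = G q \<longleftrightarrow> g p = g q \<and> E p = E q) \<and>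
        (g p = g q \<longrightarrow> E p = E q \<or> \<bar>E p - E q\<bar> > 1)"
    and 5: "0 < m \<longrightarrow> (\<exists>p\<in>R. G p = m - 1 \<and> g p = c \<and> E p = z)"
    using assms unfolding scanned_def by - (elim conjE, assumption)+
  show "p \<notin> R \<Longrightarrow> G p = g p" using 1 by blast
  show "G ` R = {..<m}" by (rule 2)
  show "p \<in> R \<Longrightarrow> E p \<le> y p" "p \<in> R \<Longrightarrow> y p \<le> E p + 1"
    "p \<in> R \<Longrightarrow> \<exists>q\<in>R. G q = G p \<and> y q = E p" "p \<in> R \<Longrightarrow> g p < c \<or> g p = c \<and> E p \<le> z"
    using bspec[OF 3, of p] by simp_all
  show "p \<in> R \<Longrightarrow> q \<in> R \<Longrightarrow> G p = G q \<longleftrightarrow> g p = g q \<and> E p = E q"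
    using bspec[OF bspec[OF 4]] by (rule conjunct1)
  show "p \<in> R \<Longrightarrow> q \<in> R \<Longrightarrow> g p = g q \<Longrightarrow> E p \<noteq> E q \<Longrightarrow> \<bar>E p - E q\<bar> > 1"
    using bspec[OF bspec[OF 4], of p q] by simp
  show "0 < m \<Longrightarrow> \<exists>p\<in>R. G p = m - 1 \<and> g p = c \<and> E p = z" using 5 by (rule mp)
qed

lemma scanned_empty: "scanned g y {} 0 c z g E"
  by (simp add: scanned_def)

text \<open>The start z of the last cell is the coordinate of a scanned point of the old cell c, and
  that point precedes p in the order.\<close>

lemma scanned_last_cell:
  assumes S: "scanned g y R m c z G E" and le: "\<And>q. q \<in> R \<Longrightarrow> key_le g y q p" and "0 < m"
  shows "c < g p \<or> c = g p \<and> z \<le> y p"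
proof -
  obtain r where r: "r \<in> R" "G r = m - 1" "g r = c" "E r = z" using scannedD(9)[OF S \<open>0 < m\<close>] by blast
  obtain q where q: "q \<in> R" "G q = G r" "y q = E r" using scannedD(5)[OF S r(1)] by blast
  then have "g q = c" using scannedD(7)[OF S q(1) r(1)] r by simp
  then show ?thesis using le[OF q(1)] q(3) r(4) by (auto simp: key_le_def)
qed

lemma scanned_same_cell:
  assumes S: "scanned g y R m c z G E" and "p \<notin> R" and le: "\<And>q. q \<in> R \<Longrightarrow> key_le g y q p"
    and p: "0 < m" "g p = c" "y p \<le> z + 1"
  shows "scanned g y (insert p R) m c z (G(p := m - 1)) (E(p := z))"
proof -
  obtain r where r: "r \<in> R" "G r = m - 1" "g r = c" "E r = z" using scannedD(9)[OF S \<open>0 < m\<close>] by blast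
  have z: "z \<le> y p" using scanned_last_cell[OF S le \<open>0 < m\<close>] p(2) by simp
  let ?G = "G(p := m - 1)" and ?E = "E(p := z)"
  have old: "q \<in> R \<Longrightarrow> ?G q = G q \<and> ?E q = E q" for q using \<open>p \<notin> R\<close> by auto
  \<comment> \<open>Point p receives the number and the start of r, and lies in the same old cell.
    Replacing p by r reduces the claims on numbers and starts to claims about R.\<close>
  define \<rho> where "\<rho> q = (if q = p then r else q)" for q
  have \<rho>: "\<rho> q \<in> R" "?G q = G (\<rho> q)" "?E q = E (\<rho> q)" "g (\<rho> q) = g q" if "q \<in> insert p R" for q
    using that r p(2) by (auto simp: \<rho>_def)
  have img: "?G ` insert p R = {..<m}"
  proof -
    have "?G ` R = G ` R" by (rule image_cong) (use old in auto)
    moreover have "m - 1 \<in> G ` R" using r(1,2) by (intro image_eqI[of _ G r]) simp_all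
    moreover have "?G ` insert p R = insert (m - 1) (?G ` R)" by (simp only: image_insert fun_upd_same)
    ultimately show ?thesis using scannedD(2)[OF S] by (simp only: insert_absorb)
  qed
  have anchor: "\<exists>q'\<in>insert p R. ?G q' = ?G q \<and> y q' = ?E q" if "q \<in> insert p R" for q
  proof -
    note \<rho>q = \<rho>[OF that]
    obtain q' where "q' \<in> R" "G q' = G (\<rho> q)" "y q' = E (\<rho> q)"
      using scannedD(5)[OF S \<rho>q(1)] by blast
    then show ?thesis using \<rho>q(2,3) old[of q'] by (intro bexI[of _ q']) simp_all
  qed
  show ?thesis
    unfolding scanned_def
  proof (intro conjI allI ballI impI)
    fix q assume "q \<in> insert p R"
    note \<rho>q = \<rho>[OF this]
    show "?E q \<le> y q" "y q \<le> ?E q + 1"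
      using z p(3) scannedD(3,4)[OF S, of q] \<open>q \<in> insert p R\<close> by (cases "q = p"; simp)+
    show "g q < c \<or> g q = c \<and> ?E q \<le> z" using scannedD(6)[OF S \<rho>q(1)] \<rho>q by simp
    show "\<exists>q'\<in>insert p R. ?G q' = ?G q \<and> y q' = ?E q" using anchor \<open>q \<in> insert p R\<close> .
    fix q' assume "q' \<in> insert p R"
    note \<rho>q' = \<rho>[OF this]
    show "?G q = ?G q' \<longleftrightarrow> g q = g q' \<and> ?E q = ?E q'"
      using scannedD(7)[OF S \<rho>q(1) \<rho>q'(1)] \<rho>q \<rho>q' by simp
    show "?E q = ?E q' \<or> \<bar>?E q - ?E q'\<bar> > 1" if "g q = g q'"
      using scannedD(8)[OF S \<rho>q(1) \<rho>q'(1)] \<rho>q \<rho>q' that by auto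
  next
    show "\<exists>q\<in>insert p R. ?G q = m - 1 \<and> g q = c \<and> ?E q = z" using r old[of r] by (intro bexI[of _ r]) simp_all
  next
    show "?G ` insert p R = {..<m}" by (rule img)
  next
    show "?G q = g q" if "q \<notin> insert p R" for q
      using scannedD(1)[OF S, of q] that by simp
  qed
qed

lemma scanned_new_cell:
  assumes S: "scanned g y R m c z G E" and "p \<notin> R" and le: "\<And>q. q \<in> R \<Longrightarrow> key_le g y q p"
    and new: "m = 0 \<or> c \<noteq> g p \<or> z + 1 < y p"
  shows "scanned g y (insert p R) (Suc m) (g p) (y p) (G(p := m)) (E(p := y p))"
proof -
  let ?G = "G(p := m)" and ?E = "E(p := y p)"
  have old: "?G q = G q \<and> ?E q = E q \<and> G q < m" if "q \<in> R" for q
    using \<open>p \<notin> R\<close> that scannedD(2)[OF S] by auto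
  \<comment> \<open>No start in cell c exceeds z, so a gap of more than 1 above z is one above all
    starts of that cell; points of other scanned cells have a smaller old number. For
    \<open>m = 0\<close> nothing has been scanned.\<close>
  have far: "g q < g p \<or> g q = g p \<and> E q + 1 < y p" if "q \<in> R" for q
  proof -
    have "0 < m" using old[OF that] by simp
    from scanned_last_cell[OF S le this] scannedD(6)[OF S that] new \<open>0 < m\<close>
    show ?thesis by auto
  qed
  have img: "?G ` insert p R = {..<Suc m}"
  proof -
    have "?G ` R = G ` R" by (rule image_cong) (use old in auto)
    moreover have "?G ` insert p R = insert m (?G ` R)" by (simp only: image_insert fun_upd_same)
    ultimately show ?thesis using scannedD(2)[OF S] by (simp only: lessThan_Suc)
  qed
  show ?thesis
    unfolding scanned_def
  proof (intro conjI allI ballI impI)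
    fix q assume q: "q \<in> insert p R"
    show "?E q \<le> y q" "y q \<le> ?E q + 1" using q scannedD(3,4)[OF S, of q] by auto
    show "g q < g p \<or> g q = g p \<and> ?E q \<le> y p"
    proof (cases "q = p")
      case False
      then show ?thesis using far[of q] q by auto
    qed simp
    show "\<exists>q'\<in>insert p R. ?G q' = ?G q \<and> y q' = ?E q"
    proof (cases "q = p")
      case False
      then have "q \<in> R" using q by simp
      from scannedD(5)[OF S this] obtain q' where "q' \<in> R" "G q' = G q" "y q' = E q" by blast
      then show ?thesis using old[OF \<open>q \<in> R\<close>] old[of q'] by (intro bexI[of _ q']) simp_all
    qed auto
    fix q' assume q': "q' \<in> insert p R"
    show "?G q = ?G q' \<longleftrightarrow> g q = g q' \<and> ?E q = ?E q'"
      using q q' scannedD(7)[OF S, of q q'] far[of q] far[of q'] old[of q] old[of q'] by auto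
    show "?E q = ?E q' \<or> \<bar>?E q - ?E q'\<bar> > 1" if "g q = g q'"
      using q q' scannedD(8)[OF S, of q q'] far[of q] far[of q'] that by auto
  next
    show "\<exists>q\<in>insert p R. ?G q = Suc m - 1 \<and> g q = g p \<and> ?E q = y p"
      by (rule bexI[of _ p]) simp_all
  next
    show "?G ` insert p R = {..<Suc m}" by (rule img)
  next
    show "?G q = g q" if "q \<notin> insert p R" for q
      using scannedD(1)[OF S, of q] that by simp
  qed
qed

text \<open>The numbers g encode agreement on the first j levels, so "same old cell" in
  \<open>scanned\<close> reads as agreement below j. The point at which a new slab starts shares the
  new number, hence agrees on all levels up to j, as a slab system demands.\<close>

lemma slab_system_Suc:
  assumes D: "slab_system n x j D" and cells: "\<And>p q. p < n \<Longrightarrow> q < n \<Longrightarrow> g p = g q \<longleftrightarrow> (\<forall>i<j. D p i = D q i)"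
    and S: "scanned g (\<lambda>p. x p j) {..<n} m c z G E"
    and D': "\<And>p i. p < n \<Longrightarrow> i < j \<Longrightarrow> D' p i = D p i" "\<And>p. p < n \<Longrightarrow> D' p j = E p"
  shows "slab_system n x (Suc j) D'"
    and "p < n \<Longrightarrow> q < n \<Longrightarrow> G p = G q \<longleftrightarrow> (\<forall>i<Suc j. D' p i = D' q i)"
proof -
  have cells': "G p = G q \<longleftrightarrow> (\<forall>i<Suc j. D' p i = D' q i)" if "p < n" "q < n" for p q
    using scannedD(7)[OF S, of p q] cells[OF that] D'(1)[OF that(1)] D'(1)[OF that(2)]
      D'(2)[OF that(1)] D'(2)[OF that(2)] that by (auto simp: less_Suc_eq)
  then show "p < n \<Longrightarrow> q < n \<Longrightarrow> G p = G q \<longleftrightarrow> (\<forall>i<Suc j. D' p i = D' q i)" .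
  show "slab_system n x (Suc j) D'"
    unfolding slab_system_def
  proof (intro allI impI)
    fix i p assume i: "i < Suc j" and p: "p < n"
    show "D' p i \<le> x p i \<and> x p i \<le> D' p i + 1 \<and>
     (\<forall>q<n. (\<forall>i'<i. D' p i' = D' q i') \<longrightarrow> D' p i = D' q i \<or> \<bar>D' p i - D' q i\<bar> > 1) \<and>
     (\<exists>q<n. (\<forall>i'\<le>i. D' q i' = D' p i') \<and> x q i = D' p i)"
    proof (cases "i = j")
      case True
      have "\<bar>D' p j - D' q j\<bar> > 1" if "q < n" "\<forall>i'<j. D' p i' = D' q i'" "D' p j \<noteq> D' q j" for q
        using scannedD(8)[OF S, of p q] cells[OF p that(1)] D' p that by simp
      moreover obtain q where "q < n" "G q = G p" "x q j = E p"
        using scannedD(5)[OF S, of p] p by auto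
      moreover have "\<forall>i'\<le>j. D' q i' = D' p i'" using cells'[of q p] calculation p by (simp add: less_Suc_eq_le)
      ultimately show ?thesis
        unfolding True using scannedD(3,4)[OF S, of p] D'(2)[OF p] p by auto
    next
      case False
      then have "i < j" using i by simp
      note sys = slab_systemD[OF D this p]
      have eq: "D' q i' = D q i'" if "q < n" "i' \<le> i" for q i' using D'(1) that \<open>i < j\<close> by simp
      obtain q where q: "q < n" "\<forall>i'\<le>i. D q i' = D p i'" "x q i = D p i" using sys(4) by blast
      have "\<exists>q<n. (\<forall>i'\<le>i. D' q i' = D' p i') \<and> x q i = D' p i"
        using q eq p by (intro exI[of _ q]) simp
      moreover have "D' p i = D' q i \<or> \<bar>D' p i - D' q i\<bar> > 1" if "q < n" "\<forall>i'<i. D' p i' = D' q i'" for q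
        using sys(3)[OF that(1)] that eq[OF p] eq[OF that(1)] by auto
      ultimately show ?thesis using sys(1,2) eq[OF p] by simp
    qed
  qed
qed

lemma slab_system_cong:
  assumes D: "slab_system n x j D" and eq: "\<And>p i. p < n \<Longrightarrow> i < j \<Longrightarrow> x p i = x' p i"
  shows "slab_system n x' j D"
  unfolding slab_system_def
proof (intro allI impI)
  fix i p assume i: "i < j" and p: "p < n"
  note sys = slab_systemD[OF D i p]
  obtain q where "q < n" "\<forall>i'\<le>i. D q i' = D p i'" "x q i = D p i" using sys(4) by blast
  then have "\<exists>q<n. (\<forall>i'\<le>i. D q i' = D p i') \<and> x' q i = D p i"
    using eq[OF _ i] by (intro exI[of _ q]) simp
  then show "D p i \<le> x' p i \<and> x' p i \<le> D p i + 1 \<and>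
     (\<forall>q<n. (\<forall>i'<i. D p i' = D q i') \<longrightarrow> D p i = D q i \<or> \<bar>D p i - D q i\<bar> > 1) \<and>
     (\<exists>q<n. (\<forall>i'\<le>i. D q i' = D p i') \<and> x' q i = D p i)"
    using sys(1-3) eq[OF p i] by auto
qed

section \<open>The scan on the machine\<close>

definition scan_step :: com where
  "scan_step = nassign ''p'' (NGet ''A'' (nvar ''k'')) ;;
     Cond (BAnd (NLess (NConst 0) (nvar ''m''))
          (BAnd (BNot (NLess (nvar ''c'') (NGet ''G'' (nvar ''p''))))
          (BAnd (BNot (NLess (NGet ''G'' (nvar ''p'')) (nvar ''c'')))
                (BNot (RLess (RAdd (RGet ''z'' (NConst 0)) (RConst 1)) (coord (nvar ''p'')))))))
       Skip
       (incr ''m'' ;; nassign ''c'' (NGet ''G'' (nvar ''p'')) ;; RSet ''z'' (NConst 0) (coord (nvar ''p''))) ;;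
     NSet ''G'' (nvar ''p'') (NSub (nvar ''m'') (NConst 1)) ;;
     RSet ''D'' (NAdd (NGet ''off'' (nvar ''p'')) (nvar ''j'')) (RGet ''z'' (NConst 0)) ;;
     incr ''k''"

definition scan :: com where
  "scan = (nassign ''k'' (NConst 0) ;; nassign ''m'' (NConst 0)) ;;
     While (NLess (nvar ''k'') (nvar ''n'')) scan_step"

lemma index_eq_iff:
  fixes p q d i j :: nat
  assumes "i < d" "j < d"
  shows "p * d + i = q * d + j \<longleftrightarrow> p = q \<and> i = j"
proof
  assume eq: "p * d + i = q * d + j"
  have "p = q" using arg_cong[OF eq, of "\<lambda>k. k div d"] assms by simp
  then show "p = q \<and> i = j" using eq by simp
qed simp

text \<open>The keys are those of the state s at the start of the scan, because \<open>G\<close> is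
  overwritten in place; for the same reason the program saves the old number of the open cell in
  \<open>c\<close>.\<close>

definition scanned_state :: "nat \<Rightarrow> nat \<Rightarrow> nat \<Rightarrow> (nat \<Rightarrow> nat) \<Rightarrow> ram \<Rightarrow> nat \<Rightarrow> ram \<Rightarrow> bool" where
  "scanned_state d n j A s k s' \<longleftrightarrow> nmem s' ''k'' 0 = k \<and>
     scanned (nmem s ''G'') (\<lambda>p. rmem s ''P'' (p * d + j)) (A ` {..<k}) (nmem s' ''m'' 0) (nmem s' ''c'' 0)
       (rmem s' ''z'' 0) (nmem s' ''G'') (\<lambda>p. rmem s' ''D'' (p * d + j)) \<and>
     (\<forall>p i. i < d \<longrightarrow> i \<noteq> j \<longrightarrow> rmem s' ''D'' (p * d + i) = rmem s ''D'' (p * d + i))"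

lemma scan_step:
  assumes I: "scanned_state d n j A s k s'" and "k < n"
    and A: "A ` {..<n} = {..<n}"
      "\<And>x y. x < y \<Longrightarrow> y < n \<Longrightarrow> key_le (nmem s ''G'') (\<lambda>p. rmem s ''P'' (p * d + j)) (A x) (A y)"
    and same: "nmem s' ''A'' = A" "nmem s' ''n'' 0 = n" "nmem s' ''j'' 0 = j" "rmem s' ''P'' = rmem s ''P''"
      "\<And>p. p < n \<Longrightarrow> nmem s' ''off'' p = p * d" and "j < d"
  shows "scanned_state d n j A s (Suc k) (outcome scan_step s')"
proof -
  let ?g = "nmem s ''G''" and ?y = "\<lambda>p. rmem s ''P'' (p * d + j)" and ?R = "A ` {..<k}"
  let ?m = "nmem s' ''m'' 0" and ?c = "nmem s' ''c'' 0" and ?z = "rmem s' ''z'' 0"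
  let ?G = "nmem s' ''G''" and ?E = "\<lambda>p. rmem s' ''D'' (p * d + j)"
  define p where "p = A k"
  have k: "nmem s' ''k'' 0 = k" using I by (simp add: scanned_state_def)
  have S: "scanned ?g ?y ?R ?m ?c ?z ?G ?E" using I by (simp add: scanned_state_def)
  \<comment> \<open>A maps \<open>{..<n}\<close> onto itself and is injective by counting; so p has
    not been scanned before and \<open>G\<close> still holds its old number.\<close>
  have "inj_on A {..<n}" using A(1) by (intro eq_card_imp_inj_on) auto
  then have "p \<notin> ?R" using \<open>k < n\<close> unfolding p_def by (auto dest: inj_onD)
  then have Gp: "?G p = ?g p" using scannedD(1)[OF S] by blast
  have le: "key_le ?g ?y q p" if "q \<in> ?R" for q using that A(2) \<open>k < n\<close> unfolding p_def by auto
  have "p < n" using A(1) \<open>k < n\<close> unfolding p_def by blast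
  have R: "A ` {..<Suc k} = insert p ?R" by (simp add: lessThan_Suc p_def)
  have off: "nmem s' ''off'' p = p * d" using same(5) \<open>p < n\<close> .
  \<comment> \<open>The condition is what simplification makes of
    \<open>q * d + j = p * d + j\<close>; the alternative \<open>d = 0\<close> is void by
    \<open>j < d\<close>.\<close>
  have upd: "(\<lambda>q. if q = p \<or> d = 0 then v else ?E q) = ?E(p := v)" for v
    using \<open>j < d\<close> by (auto simp: fun_eq_iff)
  have other: "((rmem s' ''D'')(p * d + j := v)) (q * d + i) = rmem s ''D'' (q * d + i)"
    if "i < d" "i \<noteq> j" for v q i
    using that \<open>j < d\<close> I by (simp add: index_eq_iff scanned_state_def)
  show ?thesis
  proof (cases "0 < ?m \<and> ?c = ?g p \<and> ?y p \<le> ?z + 1")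
    case True
    have "scanned ?g ?y (insert p ?R) ?m ?c ?z (?G(p := ?m - 1)) (?E(p := ?z))"
      using True by (intro scanned_same_cell[OF S \<open>p \<notin> ?R\<close> le]) auto
    moreover have "outcome scan_step s' = nupd ''k'' 0 (Suc k) (rupd ''D'' (p * d + j) ?z
        (nupd ''G'' p (?m - 1) (nupd ''p'' 0 p s')))"
      using True by (simp add: scan_step_def coord_def k off same Gp p_def[symmetric])
    ultimately show ?thesis using other by (simp add: scanned_state_def R upd)
  next
    case False
    have "scanned ?g ?y (insert p ?R) (Suc ?m) (?g p) (?y p) (?G(p := ?m)) (?E(p := ?y p))"
      using False by (intro scanned_new_cell[OF S \<open>p \<notin> ?R\<close> le]) auto
    moreover have "outcome scan_step s' = nupd ''k'' 0 (Suc k) (rupd ''D'' (p * d + j) (?y p)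
        (nupd ''G'' p ?m (rupd ''z'' 0 (?y p) (nupd ''c'' 0 (?g p) (nupd ''m'' 0 (Suc ?m) (nupd ''p'' 0 p s'))))))"
      using False by (auto simp: scan_step_def coord_def k off same Gp p_def[symmetric])
    ultimately show ?thesis using other by (simp add: scanned_state_def R upd)
  qed
qed

lemma scan:
  assumes A: "nmem s ''A'' ` {..<n} = {..<n}"
      "\<And>x y. x < y \<Longrightarrow> y < n \<Longrightarrow> level_le s (nmem s ''A'' x) (nmem s ''A'' y)"
    and s: "nmem s ''n'' 0 = n" "nmem s ''j'' 0 = j"
      "\<And>p. p < n \<Longrightarrow> nmem s ''off'' p = p * d" and "j < d"
  shows "runs scan s (100 * n + 100) (scanned_state d n j (nmem s ''A'') s n)"
  unfolding scan_def
proof (rule runs_straight_Seq)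
  let ?s = "outcome (nassign ''k'' (NConst 0) ;; nassign ''m'' (NConst 0)) s"
  let ?I = "scanned_state d n j (nmem s ''A'') s"
  have writes: "nwrites scan_step = {''p'', ''m'', ''c'', ''G'', ''k''}" "rwrites scan_step = {''z'', ''D''}"
    by (auto simp: scan_step_def)
  have A_less: "nmem s ''A'' x < n" if "x < n" for x using A(1) that by blast
  have le: "key_le (nmem s ''G'') (\<lambda>p. rmem s ''P'' (p * d + j)) (nmem s ''A'' x) (nmem s ''A'' y)"
    if "x < y" "y < n" for x y
    using A(2)[OF that] A_less[of x] A_less[of y] that s by (simp add: key_le_def point_key_def)
  show "runs (While (NLess (nvar ''k'') (nvar ''n'')) scan_step) ?s (100 * n + 50) (?I n)"
  proof (rule runs_While[where I = ?I and N = n])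
    show "?I 0 ?s" using scanned_empty by (simp add: scanned_state_def)
    fix k s' assume "k < n" and I: "?I k s'" and fr: "frame scan_step ?s s'"
    have same: "nmem s' ''A'' = nmem s ''A''" "nmem s' ''n'' 0 = n" "nmem s' ''j'' 0 = j"
        "rmem s' ''P'' = rmem s ''P''" "\<And>p. p < n \<Longrightarrow> nmem s' ''off'' p = p * d"
      using frameD[OF fr] s by (simp_all add: writes)
    have "?I (Suc k) (outcome scan_step s')"
      by (rule scan_step[OF I \<open>k < n\<close> A(1) le same \<open>j < d\<close>])
    then have "runs scan_step s' 90 (?I (Suc k))"
      by (intro runs_straight) (auto simp: scan_step_def coord_def)
    then show "bval (NLess (nvar ''k'') (nvar ''n'')) s' \<and> runs scan_step s' 90 (?I (Suc k))"
      using I same \<open>k < n\<close> by (simp add: scanned_state_def)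
  next
    fix s' assume "?I n s'" "frame scan_step ?s s'"
    then show "\<not> bval (NLess (nvar ''k'') (nvar ''n'')) s'"
      using frameD[of scan_step ?s s'] s by (simp add: scanned_state_def writes)
  qed simp_all
qed simp_all

section \<open>The program\<close>

text \<open>The memory cell m is uninitialised before the first level, hence the guard \<open>0 < j\<close>.\<close>

definition level_state :: "nat \<Rightarrow> nat \<Rightarrow> (nat \<Rightarrow> nat \<Rightarrow> real) \<Rightarrow> nat \<Rightarrow> ram \<Rightarrow> bool" where
  "level_state d n x j s \<longleftrightarrow> nmem s ''j'' 0 = j \<and> nmem s ''A'' ` {..<n} = {..<n} \<and>
     slab_system n x j (\<lambda>p i. rmem s ''D'' (p * d + i)) \<and>
     (\<forall>p<n. \<forall>q<n. nmem s ''G'' p = nmem s ''G'' q \<longleftrightarrow>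
        (\<forall>i<j. rmem s ''D'' (p * d + i) = rmem s ''D'' (q * d + i))) \<and>
     (0 < j \<longrightarrow> nmem s ''G'' ` {..<n} = {..<nmem s ''m'' 0})"

definition do_level :: com where
  "do_level = sort_points ;; scan ;; incr ''j''"

lemma writes_sort_points:
  "nwrites sort_points = {''w'', ''k'', ''a'', ''mid'', ''b'', ''hi'', ''B'', ''A''}" "rwrites sort_points = {}"
  by (auto simp: sort_points_def merge_blocks_def start_block_def take_next_def copy_back_def)

lemma writes_scan:
  "nwrites scan = {''k'', ''m'', ''p'', ''c'', ''G''}" "rwrites scan = {''z'', ''D''}"
  by (auto simp: scan_def scan_step_def)

lemma do_level:
  assumes L: "level_state d n x j s" and s: "nmem s ''n'' 0 = n"
      "\<And>p. p < n \<Longrightarrow> nmem s ''off'' p = p * d" "\<And>p i. p < n \<Longrightarrow> i < d \<Longrightarrow> rmem s ''P'' (p * d + i) = x p i"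
    and "j < d"
  shows "runs do_level s (passes n * (250 * n + 300) + 100 * n + 150) (level_state d n x (Suc j))"
  unfolding do_level_def
proof (rule runs_Seq[OF sort_points[OF s(1)]])
  fix s1 assume s1: "nmem s1 ''A'' ` {..<n} = nmem s ''A'' ` {..<n} \<and>
    (\<forall>x y. x < y \<longrightarrow> y < n \<longrightarrow> level_le s (nmem s1 ''A'' x) (nmem s1 ''A'' y))"
    and fr1: "frame sort_points s s1"
  have A1: "nmem s1 ''A'' ` {..<n} = {..<n}" using s1 L by (simp add: level_state_def)
  have same1: "nmem s1 ''n'' 0 = n" "nmem s1 ''j'' 0 = j" "nmem s1 ''G'' = nmem s ''G''"
    "rmem s1 ''P'' = rmem s ''P''" "rmem s1 ''D'' = rmem s ''D''" "nmem s1 ''off'' = nmem s ''off''"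
    using frameD[OF fr1] s(1) L by (simp_all add: writes_sort_points level_state_def)
  have le1: "level_le s1 (nmem s1 ''A'' x) (nmem s1 ''A'' y)" if "x < y" "y < n" for x y
    using s1 that level_le_frame[OF fr1] by (simp add: writes_sort_points)
  show "runs (scan ;; incr ''j'') s1 (100 * n + 110) (level_state d n x (Suc j))"
  proof (rule runs_Seq[OF scan[OF A1 le1 same1(1,2) _ \<open>j < d\<close>]])
    fix s2 assume s2: "scanned_state d n j (nmem s1 ''A'') s1 n s2" and fr2: "frame scan s1 s2"
    have same2: "nmem s2 ''A'' = nmem s1 ''A''" "nmem s2 ''j'' 0 = j"
      using frameD[OF fr2] same1 by (simp_all add: writes_scan)
    have S: "scanned (nmem s ''G'') (\<lambda>p. rmem s ''P'' (p * d + j)) {..<n} (nmem s2 ''m'' 0) (nmem s2 ''c'' 0)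
       (rmem s2 ''z'' 0) (nmem s2 ''G'') (\<lambda>p. rmem s2 ''D'' (p * d + j))"
      and D: "\<And>p i. i < d \<Longrightarrow> i \<noteq> j \<Longrightarrow> rmem s2 ''D'' (p * d + i) = rmem s ''D'' (p * d + i)"
      using s2 by (simp_all add: scanned_state_def A1 same1)
    note sys = slab_system_Suc[where x = "\<lambda>p i. rmem s ''P'' (p * d + i)" and D = "\<lambda>p i. rmem s ''D'' (p * d + i)"
        and D' = "\<lambda>p i. rmem s2 ''D'' (p * d + i)" and j = j, OF _ _ S]
    \<comment> \<open>x and the array \<open>P\<close> agree only for points below n and coordinates
      below d, so the system is transported to \<open>P\<close> for the scan and back
      afterwards.\<close>
    have sys_j: "slab_system n (\<lambda>p i. rmem s ''P'' (p * d + i)) j (\<lambda>p i. rmem s ''D'' (p * d + i))"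
      by (rule slab_system_cong[of n x]) (use L s(3) \<open>j < d\<close> in \<open>auto simp: level_state_def\<close>)
    have cells: "nmem s ''G'' p = nmem s ''G'' q \<longleftrightarrow>
        (\<forall>i<j. rmem s ''D'' (p * d + i) = rmem s ''D'' (q * d + i))" if "p < n" "q < n" for p q
      using L that by (simp add: level_state_def)
    have sys': "slab_system n x (Suc j) (\<lambda>p i. rmem s2 ''D'' (p * d + i))"
      by (rule slab_system_cong[OF sys(1)[OF sys_j cells]]) (use D s(3) \<open>j < d\<close> in simp_all)
    have cells': "nmem s2 ''G'' p = nmem s2 ''G'' q \<longleftrightarrow>
        (\<forall>i<Suc j. rmem s2 ''D'' (p * d + i) = rmem s2 ''D'' (q * d + i))" if "p < n" "q < n" for p q
      using sys(2)[OF sys_j cells _ _ that] D \<open>j < d\<close> by simp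
    show "runs (incr ''j'') s2 10 (level_state d n x (Suc j))"
      by (rule runs_straight)
        (use A1 same2 sys' cells' scannedD(2)[OF S] in \<open>simp_all add: level_state_def\<close>)
  qed (use same1 s in simp_all)
qed simp

text \<open>Natural numbers cannot be multiplied, so \<open>off\<close> tabulates
  \<open>p * d\<close> by repeated addition. Before any level all points share one cell, numbered
  0.\<close>

definition setup_points :: com where
  "setup_points = (nassign ''k'' (NConst 0) ;; nassign ''o'' (NConst 0)) ;;
     While (NLess (nvar ''k'') (nvar ''n''))
       (NSet ''off'' (nvar ''k'') (nvar ''o'') ;; NSet ''A'' (nvar ''k'') (nvar ''k'') ;;
        NSet ''G'' (nvar ''k'') (NConst 0) ;; nassign ''o'' (NAdd (nvar ''o'') (nvar ''d'')) ;; incr ''k'')"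

lemma setup_points:
  assumes "nmem s ''n'' 0 = n" "nmem s ''d'' 0 = d"
  shows "runs setup_points s (50 * n + 50) (\<lambda>s'. \<forall>p<n. nmem s' ''off'' p = p * d \<and>
    nmem s' ''A'' p = p \<and> nmem s' ''G'' p = 0)"
  unfolding setup_points_def
proof (rule runs_straight_Seq)
  let ?s = "outcome (nassign ''k'' (NConst 0) ;; nassign ''o'' (NConst 0)) s"
  let ?b = "NSet ''off'' (nvar ''k'') (nvar ''o'') ;; NSet ''A'' (nvar ''k'') (nvar ''k'') ;;
        NSet ''G'' (nvar ''k'') (NConst 0) ;; nassign ''o'' (NAdd (nvar ''o'') (nvar ''d'')) ;; incr ''k''"
  let ?I = "\<lambda>k s'. nmem s' ''k'' 0 = k \<and> nmem s' ''o'' 0 = k * d \<and>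
    (\<forall>p<k. nmem s' ''off'' p = p * d \<and> nmem s' ''A'' p = p \<and> nmem s' ''G'' p = 0)"
  show "runs (While (NLess (nvar ''k'') (nvar ''n'')) ?b) ?s (50 * n + 20)
      (\<lambda>s'. \<forall>p<n. nmem s' ''off'' p = p * d \<and> nmem s' ''A'' p = p \<and> nmem s' ''G'' p = 0)"
  proof (rule runs_While[where I = ?I and N = n])
    fix k s' assume "k < n" and I: "?I k s'" and fr: "frame ?b ?s s'"
    have same: "nmem s' ''n'' 0 = n" "nmem s' ''d'' 0 = d" using frameD[OF fr] assms by simp_all
    have "runs ?b s' 40 (?I (Suc k))"
      by (rule runs_straight) (use I same in \<open>auto simp: less_Suc_eq\<close>)
    then show "bval (NLess (nvar ''k'') (nvar ''n'')) s' \<and> runs ?b s' 40 (?I (Suc k))"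
      using I same \<open>k < n\<close> by simp
  next
    fix s' assume "?I n s'" "frame ?b ?s s'"
    then show "\<not> bval (NLess (nvar ''k'') (nvar ''n'')) s'"
      using frameD[of ?b ?s s'] assms by simp
  qed simp_all
qed simp_all

definition write_corner :: com where
  "write_corner = nassign ''i'' (NConst 0) ;; While (NLess (nvar ''i'') (nvar ''d''))
     (RSet ''C'' (NAdd (NGet ''off'' (NGet ''G'' (nvar ''k''))) (nvar ''i''))
        (RGet ''D'' (NAdd (NGet ''off'' (nvar ''k'')) (nvar ''i''))) ;; incr ''i'')"

lemma write_corner:
  assumes s: "nmem s ''d'' 0 = d" "nmem s ''k'' 0 = k" "nmem s ''off'' k = k * d"
    "nmem s ''G'' k = g" "nmem s ''off'' g = g * d"
  shows "runs write_corner s (50 * d + 50) (\<lambda>s'. \<forall>q. \<forall>i<d. rmem s' ''C'' (q * d + i) =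
    (if q = g then rmem s ''D'' (k * d + i) else rmem s ''C'' (q * d + i)))"
  unfolding write_corner_def
proof (rule runs_straight_Seq)
  let ?s = "outcome (nassign ''i'' (NConst 0)) s"
  let ?b = "RSet ''C'' (NAdd (NGet ''off'' (NGet ''G'' (nvar ''k''))) (nvar ''i''))
        (RGet ''D'' (NAdd (NGet ''off'' (nvar ''k'')) (nvar ''i''))) ;; incr ''i''"
  let ?I = "\<lambda>i s'. nmem s' ''i'' 0 = i \<and> (\<forall>q. \<forall>i'<d. rmem s' ''C'' (q * d + i') =
    (if q = g \<and> i' < i then rmem s ''D'' (k * d + i') else rmem s ''C'' (q * d + i')))"
  show "runs (While (NLess (nvar ''i'') (nvar ''d'')) ?b) ?s (40 * d + 40) (\<lambda>s'. \<forall>q. \<forall>i<d.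
      rmem s' ''C'' (q * d + i) = (if q = g then rmem s ''D'' (k * d + i) else rmem s ''C'' (q * d + i)))"
  proof (rule runs_While[where I = ?I and N = d])
    fix i s' assume "i < d" and I: "?I i s'" and fr: "frame ?b ?s s'"
    have same: "nmem s' ''d'' 0 = d" "nmem s' ''k'' 0 = k" "nmem s' ''off'' k = k * d"
      "nmem s' ''G'' k = g" "nmem s' ''off'' g = g * d" "rmem s' ''D'' = rmem s ''D''"
      using frameD[OF fr] s by simp_all
    have "outcome ?b s' = nupd ''i'' 0 (Suc i) (rupd ''C'' (g * d + i) (rmem s ''D'' (k * d + i)) s')"
      using I same by simp
    moreover have "((rmem s' ''C'')(g * d + i := rmem s ''D'' (k * d + i))) (q * d + i') =
        (if q = g \<and> i' < Suc i then rmem s ''D'' (k * d + i') else rmem s ''C'' (q * d + i'))"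
      if "i' < d" for q i'
      using I that \<open>i < d\<close> by (cases "i' = i") (simp_all add: index_eq_iff less_Suc_eq)
    ultimately have "?I (Suc i) (outcome ?b s')" by simp
    then have "runs ?b s' 30 (?I (Suc i))"
      by (intro runs_straight[where c = ?b and Q = "?I (Suc i)"]) (assumption | simp; fail)+
    then show "bval (NLess (nvar ''i'') (nvar ''d'')) s' \<and> runs ?b s' 30 (?I (Suc i))"
      using I same \<open>i < d\<close> by simp
  next
    fix s' assume "?I d s'" "frame ?b ?s s'"
    then show "\<not> bval (NLess (nvar ''i'') (nvar ''d'')) s'"
      using frameD[of ?b ?s s'] s by simp
  qed simp_all
qed simp_all

text \<open>Every point of a cell writes the corner of the cell into the slot given by the cell
  number, always with the same values. This removes repetitions without any search, in time linear
  in d per point.\<close>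

definition write_corners :: com where
  "write_corners = nassign ''k'' (NConst 0) ;; While (NLess (nvar ''k'') (nvar ''n''))
     (write_corner ;; incr ''k'')"

lemma write_corners:
  assumes s: "nmem s ''n'' 0 = n" "nmem s ''d'' 0 = d" "\<And>p. p < n \<Longrightarrow> nmem s ''off'' p = p * d"
    "\<And>p. p < n \<Longrightarrow> nmem s ''G'' p < n"
    and cells: "\<And>p q i. p < n \<Longrightarrow> q < n \<Longrightarrow> nmem s ''G'' p = nmem s ''G'' q \<Longrightarrow> i < d \<Longrightarrow>
      rmem s ''D'' (p * d + i) = rmem s ''D'' (q * d + i)"
  shows "runs write_corners s (n * (50 * d + 80) + 50) (\<lambda>s'. \<forall>p<n. \<forall>i<d.
    rmem s' ''C'' (nmem s ''G'' p * d + i) = rmem s ''D'' (p * d + i))"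
  unfolding write_corners_def
proof (rule runs_straight_Seq)
  let ?s = "outcome (nassign ''k'' (NConst 0)) s"
  let ?b = "write_corner ;; incr ''k''"
  let ?I = "\<lambda>k s'. nmem s' ''k'' 0 = k \<and> (\<forall>p<k. \<forall>i<d.
    rmem s' ''C'' (nmem s ''G'' p * d + i) = rmem s ''D'' (p * d + i))"
  have writes: "nwrites write_corner = {''i''}" "rwrites write_corner = {''C''}"
    by (auto simp: write_corner_def)
  show "runs (While (NLess (nvar ''k'') (nvar ''n'')) ?b) ?s (n * (50 * d + 80) + 40) (\<lambda>s'. \<forall>p<n. \<forall>i<d.
    rmem s' ''C'' (nmem s ''G'' p * d + i) = rmem s ''D'' (p * d + i))"
  proof (rule runs_While[where I = ?I and N = n])
    fix k s' assume "k < n" and I: "?I k s'" and fr: "frame ?b ?s s'"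
    have same: "nmem s' ''d'' 0 = d" "nmem s' ''n'' 0 = n" "nmem s' ''off'' = nmem s ''off''"
      "nmem s' ''G'' = nmem s ''G''" "rmem s' ''D'' = rmem s ''D''" "nmem s' ''k'' 0 = k"
      using frameD[OF fr] s I by (simp_all add: writes)
    have "runs ?b s' (50 * d + 70) (?I (Suc k))"
    proof (rule runs_Seq[OF write_corner[of s' d k "nmem s ''G'' k"]])
      fix s1 assume s1: "\<forall>q. \<forall>i<d. rmem s1 ''C'' (q * d + i) = (if q = nmem s ''G'' k
          then rmem s' ''D'' (k * d + i) else rmem s' ''C'' (q * d + i))"
        and fr1: "frame write_corner s' s1"
      have "nmem s1 ''k'' 0 = k" using frameD[OF fr1] same by (simp add: writes)
      moreover have "rmem s1 ''C'' (nmem s ''G'' p * d + i) = rmem s ''D'' (p * d + i)"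
        if "p < Suc k" "i < d" for p i
      proof (cases "nmem s ''G'' p = nmem s ''G'' k")
        case True
        have "rmem s ''D'' (p * d + i) = rmem s ''D'' (k * d + i)"
          by (rule cells) (use True that \<open>k < n\<close> in simp_all)
        then show ?thesis using s1 True that same by simp
      next
        case False
        then have "p < k" using that by (auto simp: less_Suc_eq)
        then show ?thesis using s1 False that I by simp
      qed
      ultimately show "runs (incr ''k'') s1 20 (?I (Suc k))"
        by (intro runs_straight) simp_all
    qed (use same s \<open>k < n\<close> in simp_all)
    then show "bval (NLess (nvar ''k'') (nvar ''n'')) s' \<and> runs ?b s' (50 * d + 70) (?I (Suc k))"
      using I same \<open>k < n\<close> by simp
  next
    fix s' assume "?I n s'" "frame ?b ?s s'"
    then show "\<not> bval (NLess (nvar ''k'') (nvar ''n'')) s'"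
      using frameD[of ?b ?s s'] s by (simp add: writes)
  next
    show "n * (50 * d + 70 + 1 + bcost (NLess (nvar ''k'') (nvar ''n''))) + 1 +
        bcost (NLess (nvar ''k'') (nvar ''n'')) \<le> n * (50 * d + 80) + 40"
      by (simp add: algebra_simps)
  qed simp_all
qed simp_all

definition slab_program :: com where
  "slab_program = setup_points ;; nassign ''j'' (NConst 0) ;;
     While (NLess (nvar ''j'') (nvar ''d'')) do_level ;; write_corners"

definition slab_time :: "nat \<Rightarrow> nat \<Rightarrow> nat" where
  "slab_time d n = d * (passes n * (250 * n + 300) + 100 * n + 200) + n * (50 * d + 150) + 200"

lemma slab_program:
  assumes s: "nmem s ''n'' 0 = n" "nmem s ''d'' 0 = d" and "d \<ge> 1"
  shows "runs slab_program s (slab_time d n) (\<lambda>s'. \<exists>D g.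
    slab_system n (\<lambda>p i. rmem s ''P'' (p * d + i)) d D \<and> g ` {..<n} = {..<nmem s' ''m'' 0} \<and>
    (\<forall>p<n. \<forall>q<n. g p = g q \<longleftrightarrow> (\<forall>i<d. D p i = D q i)) \<and>
    (\<forall>p<n. \<forall>i<d. rmem s' ''C'' (g p * d + i) = D p i))"
    (is "runs _ _ _ ?Q")
  unfolding slab_program_def
proof (rule runs_Seq[OF setup_points[OF s]])
  let ?x = "\<lambda>p i. rmem s ''P'' (p * d + i)"
  have writes_setup: "nwrites setup_points = {''k'', ''o'', ''off'', ''A'', ''G''}" "rwrites setup_points = {}"
    by (auto simp: setup_points_def)
  have writes_level: "nwrites do_level = {''w'', ''k'', ''a'', ''mid'', ''b'', ''hi'', ''B'', ''A'', ''m'', ''p'', ''c'', ''G'', ''j''}"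
      "rwrites do_level = {''z'', ''D''}"
    by (auto simp: do_level_def writes_sort_points writes_scan)
  have writes_corners: "nwrites write_corners = {''k'', ''i''}"
    by (auto simp: write_corners_def write_corner_def)
  let ?B = "passes n * (250 * n + 300) + 100 * n + 150"
  fix s1 assume s1: "\<forall>p<n. nmem s1 ''off'' p = p * d \<and> nmem s1 ''A'' p = p \<and> nmem s1 ''G'' p = 0"
    and fr1: "frame setup_points s s1"
  have same1: "nmem s1 ''n'' 0 = n" "nmem s1 ''d'' 0 = d" "rmem s1 ''P'' = rmem s ''P''"
    using frameD[OF fr1] s by (simp_all add: writes_setup)
  let ?s1 = "outcome (nassign ''j'' (NConst 0)) s1"
  show "runs (nassign ''j'' (NConst 0) ;; While (NLess (nvar ''j'') (nvar ''d'')) do_level ;; write_corners)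
      s1 (d * (?B + 50) + n * (50 * d + 80) + 100) ?Q"
  proof (rule runs_straight_Seq)
    show "runs (While (NLess (nvar ''j'') (nvar ''d'')) do_level ;; write_corners)
        ?s1 (d * (?B + 50) + n * (50 * d + 80) + 80) ?Q"
    proof (rule runs_Seq)
      show "runs (While (NLess (nvar ''j'') (nvar ''d'')) do_level) ?s1 (d * (?B + 50) + 10)
          (level_state d n ?x d)"
      proof (rule runs_While[where I = "level_state d n ?x" and N = d])
        have "nmem ?s1 ''A'' ` {..<n} = (\<lambda>p. p) ` {..<n}" using s1 by (intro image_cong) auto
        then show "level_state d n ?x 0 ?s1" using s1 by (simp add: level_state_def slab_system_def)
        fix j s' assume "j < d" and I: "level_state d n ?x j s'" and fr: "frame do_level ?s1 s'"
        have same: "nmem s' ''n'' 0 = n" "nmem s' ''d'' 0 = d" "rmem s' ''P'' = rmem s ''P''"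
          "\<And>p. p < n \<Longrightarrow> nmem s' ''off'' p = p * d"
          using frameD[OF fr] same1 s1 by (simp_all add: writes_level)
        have "runs do_level s' ?B (level_state d n ?x (Suc j))"
          by (rule do_level[OF I same(1,4) _ \<open>j < d\<close>]) (simp_all add: same)
        then show "bval (NLess (nvar ''j'') (nvar ''d'')) s' \<and> runs do_level s' ?B (level_state d n ?x (Suc j))"
          using I same \<open>j < d\<close> by (simp add: level_state_def)
      next
        fix s' assume "level_state d n ?x d s'" "frame do_level ?s1 s'"
        then show "\<not> bval (NLess (nvar ''j'') (nvar ''d'')) s'"
          using frameD[of do_level ?s1 s'] same1 by (simp add: level_state_def writes_level)
      next
        show "d * (?B + 1 + bcost (NLess (nvar ''j'') (nvar ''d''))) + 1 + bcost (NLess (nvar ''j'') (nvar ''d''))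
          \<le> d * (?B + 50) + 10" by (simp add: add_mult_distrib2)
      qed
    next
      fix s2 assume s2: "level_state d n ?x d s2"
        and fr2: "frame (While (NLess (nvar ''j'') (nvar ''d'')) do_level) ?s1 s2"
      let ?g = "nmem s2 ''G''" and ?D = "\<lambda>p i. rmem s2 ''D'' (p * d + i)"
      have same2: "nmem s2 ''n'' 0 = n" "nmem s2 ''d'' 0 = d" "\<And>p. p < n \<Longrightarrow> nmem s2 ''off'' p = p * d"
        using frameD[OF fr2] same1 s1 by (simp_all add: writes_level)
      \<comment> \<open>By \<open>d \<ge> 1\<close> at least one level has run, so \<open>m\<close>
        holds the number of cells.\<close>
      have D: "slab_system n ?x d ?D" and g: "?g ` {..<n} = {..<nmem s2 ''m'' 0}"
        and cells: "\<forall>p<n. \<forall>q<n. ?g p = ?g q \<longleftrightarrow> (\<forall>i<d. ?D p i = ?D q i)"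
        using s2 \<open>d \<ge> 1\<close> by (simp_all add: level_state_def)
      \<comment> \<open>There are at most n cells, so cell numbers are valid indices into
        \<open>off\<close>.\<close>
      have "nmem s2 ''m'' 0 \<le> n" using card_image_le[of "{..<n}" ?g] g by simp
      then have g_less: "?g p < n" if "p < n" for p
        using imageI[of p "{..<n}" ?g] that unfolding g by simp
      show "runs write_corners s2 (n * (50 * d + 80) + 50) ?Q"
      proof (rule runs_conseq[OF write_corners[OF same2 g_less]])
        fix s3 assume "\<forall>p<n. \<forall>i<d. rmem s3 ''C'' (?g p * d + i) = ?D p i" "frame write_corners s2 s3"
        moreover from this(2) have "nmem s3 ''m'' = nmem s2 ''m''"
          by (rule frameD) (simp add: writes_corners)
        ultimately show "?Q s3" using D g cells by (intro exI[of _ ?D] exI[of _ ?g]) simp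
      next
        fix p q i assume "p < n" "q < n" "?g p = ?g q" "i < d"
        then show "?D p i = ?D q i" using cells by blast
      qed simp_all
    qed simp
  qed simp_all
qed (simp add: slab_time_def algebra_simps)

section \<open>Asymptotic running time\<close>

lemma passes_le_log:
  assumes "n \<ge> 2"
  shows "real (passes n) \<le> 2 * log 2 (real n)"
proof (cases "passes n")
  case (Suc r)
  have "real r = log 2 (2 ^ r)" by simp
  also have "\<dots> \<le> log 2 (real n)"
    using two_power_less[of r n] Suc by (subst log_le_cancel_iff) (auto simp: less_imp_le simp flip: of_nat_power)
  finally have "real r \<le> log 2 (real n)" .
  \<comment> \<open>Rounding the logarithm up costs at most 1, which doubling absorbs.\<close>
  moreover have "1 \<le> log 2 (real n)" using assms by simp
  ultimately show ?thesis using Suc by simp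
qed (use assms in simp)

lemma slab_time_bound:
  "(\<lambda>(d, n). real (slab_time d n)) \<in>
     O[principal {(d, n). d \<ge> 1 \<and> n \<ge> 2}](\<lambda>(d, n). real d * (real n * log 2 (real n)))"
proof (rule bigoI[where c = 2000], unfold eventually_principal, clarify)
  fix d n :: nat assume d: "1 \<le> d" and n: "2 \<le> n"
  define X where "X = real d * (real n * log 2 (real n))"
  have lg: "1 \<le> log 2 (real n)" using n by simp
  have dn: "real d * real n \<le> X" unfolding X_def using lg d n by (simp add: mult_left_mono)
  have "real d \<le> real d * real n" "real n \<le> real d * real n" "1 \<le> real d * real n"
    using d n by (simp_all add: mult_ge1_I)
  then have bounds: "real d \<le> X" "real n \<le> X" "1 \<le> X" using dn by linarith+
  have p: "real d * (real n * real (passes n)) \<le> 2 * X"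
  proof -
    have "real d * (real n * real (passes n)) \<le> real d * (real n * (2 * log 2 (real n)))"
      by (intro mult_left_mono passes_le_log[OF n]) simp_all
    then show ?thesis by (simp add: X_def)
  qed
  have "real d * real (passes n) \<le> real d * (real n * real (passes n))"
    using n mult_right_mono[of 1 "real n" "real (passes n)"] by (intro mult_left_mono) simp_all
  then have p': "real d * real (passes n) \<le> 2 * X" using p by linarith
  have "real (slab_time d n) = 250 * (real d * (real n * real (passes n))) + 300 * (real d * real (passes n))
      + 150 * (real d * real n) + 200 * real d + 150 * real n + 200"
    by (simp add: slab_time_def algebra_simps)
  \<comment> \<open>The terms add up to at most \<open>1800 * X\<close>, where those with
    \<open>passes n\<close> count twice.\<close>
  also have "\<dots> \<le> 2000 * X" using p p' bounds dn by linarith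
  finally show "norm (real (slab_time d n)) \<le> 2000 * norm (real d * (real n * log 2 (real n)))"
    using bounds(3) by (simp add: X_def)
qed

theorem theorem3:
  "\<exists>(prog :: com) (T :: nat \<Rightarrow> nat \<Rightarrow> nat).
     (\<lambda>(d, n). real (T d n)) \<in>
       O[principal {(d, n). d \<ge> 1 \<and> n \<ge> 2}](\<lambda>(d, n). real d * (real n * log 2 (real n))) \<and>
     (\<forall>(d :: nat) (n :: nat) (P :: (nat \<Rightarrow> real) set) (s :: ram).
        d \<ge> 1 \<longrightarrow> P \<subseteq> Rspace d \<longrightarrow> finite P \<longrightarrow> card P = n \<longrightarrow> ram_input d P s \<longrightarrow>
        (\<exists>t s' S. exec prog s t s' \<and> t \<le> T d n \<and> ram_output d S s' \<and>
           one_ply_cover d P S \<and>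
           (\<forall>S'. min_one_ply_cover d P S' \<longrightarrow> card S \<le> 2 ^ (d - 1) * card S')))"
proof (intro exI[of _ slab_program] exI[of _ slab_time] conjI slab_time_bound allI impI)
  fix d n :: nat and P :: "(nat \<Rightarrow> real) set" and s :: ram
  assume "d \<ge> 1" and "card P = n" and input: "ram_input d P s"
  let ?x = "\<lambda>p i. rmem s ''P'' (p * d + i)"
  have s: "nmem s ''n'' 0 = n" "nmem s ''d'' 0 = d" and P: "P = (\<lambda>p. restrict (?x p) {..<d}) ` {..<n}"
    using input \<open>card P = n\<close> by (simp_all add: ram_input_def bij_betw_def)
  obtain t s' where exec: "exec slab_program s t s'" "t \<le> slab_time d n"
    and "\<exists>D g. slab_system n ?x d D \<and> g ` {..<n} = {..<nmem s' ''m'' 0} \<and>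
      (\<forall>p<n. \<forall>q<n. g p = g q \<longleftrightarrow> (\<forall>i<d. D p i = D q i)) \<and>
      (\<forall>p<n. \<forall>i<d. rmem s' ''C'' (g p * d + i) = D p i)"
    using slab_program[OF s \<open>d \<ge> 1\<close>] unfolding runs_def
    by - (erule exE, erule exE, erule conjE, erule conjE, rule that)
  then obtain D g where D: "slab_system n ?x d D" and g: "g ` {..<n} = {..<nmem s' ''m'' 0}"
    and cells: "\<And>p q. p < n \<Longrightarrow> q < n \<Longrightarrow> g p = g q \<longleftrightarrow> (\<forall>i<d. D p i = D q i)"
    and C: "\<And>p i. p < n \<Longrightarrow> i < d \<Longrightarrow> rmem s' ''C'' (g p * d + i) = D p i"
    by (elim exE conjE) simp
  let ?S = "(\<lambda>p. hypercube d (D p)) ` {..<n}"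
  have cube: "hypercube d (\<lambda>j. rmem s' ''C'' (g p * d + j)) = hypercube d (D p)" if "p < n" for p
    by (rule hypercube_cong) (rule C[OF that])
  \<comment> \<open>Equal cubes have equal corners, and equal corners belong to equal cell numbers;
    so the used slots of \<open>C\<close> never repeat a cube.\<close>
  have "inj_on (\<lambda>k. hypercube d (\<lambda>j. rmem s' ''C'' (k * d + j))) (g ` {..<n})"
  proof (rule inj_onI, elim imageE)
    fix k k' p q
    assume eq: "hypercube d (\<lambda>j. rmem s' ''C'' (k * d + j)) = hypercube d (\<lambda>j. rmem s' ''C'' (k' * d + j))"
      and k: "k = g p" "k' = g q" and "p \<in> {..<n}" "q \<in> {..<n}"
    then have "p < n" "q < n" by simp_all
    moreover have "hypercube d (D p) = hypercube d (D q)"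
      using eq unfolding k cube[OF \<open>p < n\<close>] cube[OF \<open>q < n\<close>] .
    ultimately show "k = k'" using slab_hypercube_eq_iff[OF D] cells unfolding k by blast
  qed
  moreover have "(\<lambda>k. hypercube d (\<lambda>j. rmem s' ''C'' (k * d + j))) ` g ` {..<n} = ?S"
    unfolding image_image by (rule image_cong) (auto simp: cube)
  ultimately have "ram_output d ?S s'" by (simp add: ram_output_def bij_betw_def g)
  moreover have "one_ply_cover d P ?S"
    unfolding P by (rule slab_system_one_ply_cover[OF D])
  moreover have "card ?S \<le> 2 ^ (d - 1) * card S'" if "min_one_ply_cover d P S'" for S'
    by (rule slab_system_card_le[OF D \<open>d \<ge> 1\<close>])
      (use that in \<open>simp_all add: min_one_ply_cover_def is_arg_min_def one_ply_cover_def flip: P\<close>)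
  ultimately show "\<exists>t s' S. exec slab_program s t s' \<and> t \<le> slab_time d n \<and> ram_output d S s' \<and>
      one_ply_cover d P S \<and> (\<forall>S'. min_one_ply_cover d P S' \<longrightarrow> card S \<le> 2 ^ (d - 1) * card S')"
    using exec by blast
qed

end
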